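(* Let $M$ be an oriented Riemannian manifold with $\dim M\ge 2$, let $\gamma:I\to M$ be a Frenet helix of order $2$ with Frenet field $\{T,N\}$ and constant curvature $\kappa$, and let $r\geq 2$ be an integer. If \[ \langle R(T,N)T,W \rangle =0 \quad \text{for all } W \in \big(\mathrm{Span}\{T,N\}\big)^\perp , \] then $\gamma$ is proper $r$-harmonic if and only if \[ \kappa^2=(r-1)\, R(N,T,N,T). \]
   Context: $M$ is an oriented Riemannian manifold with Levi-Civita connection $\nabla$, curvature $R(X,Y)Z=\nabla_X\nabla_YZ-\nabla_Y\nabla_XZ-\nabla_{[X,Y]}Z$ and $R(X,Y,Z,W)=\langle R(X,Y)W,Z\rangle$. Curves $\gamma:I\to M$ ($I\subset\mathbb{R}$ an interval) are smooth and parametrized by arc length, with unit tangent $T=\gamma'$. Put $\nabla^0_TT=T$, $\nabla_T^kT=\nabla_T(\nabla_T^{k-1}T)$. For an integer $r\ge 2$, $\gamma$ is $r$-harmonic if \[ \tau_r(\gamma)=\nabla^{2r-1}_T T+ \sum_{\ell=0}^{r-2}(-1)^\ell R\left (\nabla^{2r-3-\ell}_T T ,\nabla^{\ell}_T T\right )T=0, \] and proper $r$-harmonic if it is $r$-harmonic and not a geodesic. A Frenet helix of order $2$ is such a curve admitting an orthonormal field $\{T,N\}$ along $\gamma$ and a constant $\kappa$ with $\nabla_TT=\kappa N$, $\nabla_TN=-\kappa T$; if $\dim M\ge 3$ then $\kappa>0$, while if $\dim M=2$ the frame $\{T,N\}$ is positively oriented and $\kappa$ may be any real number. The conditions on $R$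 are required along $\gamma$.
   Formalization: The right-hand side is "κ ≠ 0 and κ² = (r−1)R(N,T,N,T)": when dim M = 2 and κ = 0 (e.g. a line in the flat plane) the equation can hold although γ is a geodesic, hence not proper r-harmonic; for κ ≠ 0 the equivalence is unchanged. *)

theory Defs
  imports "HOL-Analysis.Analysis"
begin

section \<open>Smooth maps between Euclidean spaces\<close>

text \<open>Meant for open \<open>S\<close>.  Over a finite-dimensional domain, \<open>C^k\<close> is the existence and continuity
  of all iterated directional derivatives of differentiable functions, as used here.\<close>

primrec Ck_on :: "nat \<Rightarrow> (real^'n) set \<Rightarrow> (real^'n \<Rightarrow> 'b::real_normed_vector) \<Rightarrow> bool" where
  "Ck_on 0 S f \<longleftrightarrow> continuous_on S f"
| "Ck_on (Suc k) S f \<longleftrightarrow>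
     (\<forall>x\<in>S. f differentiable (at x)) \<and> (\<forall>v. Ck_on k S (\<lambda>x. frechet_derivative f (at x) v))"

definition smooth_on :: "(real^'n) set \<Rightarrow> (real^'n \<Rightarrow> 'b::real_normed_vector) \<Rightarrow> bool" where
  "smooth_on S f \<longleftrightarrow> (\<forall>k. Ck_on k S f)"

text \<open>Derivatives of curves are taken within the interval \<open>I\<close>, hence one-sided at end points.\<close>

primrec nth_deriv_within :: "real set \<Rightarrow> nat \<Rightarrow> (real \<Rightarrow> real^'n) \<Rightarrow> real \<Rightarrow> real^'n" where
  "nth_deriv_within I 0 f = f"
| "nth_deriv_within I (Suc k) f = (\<lambda>t. vector_derivative (nth_deriv_within I k f) (at t within I))"


section \<open>Smooth manifolds\<close>

text \<open>A chart is a domain together with a coordinate map.  Values of the coordinate map outside the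
  domain are irrelevant.  The underlying set of the manifold is the carrier of a topology.\<close>

type_synonym ('a, 'n) chart = "'a set \<times> ('a \<Rightarrow> real^'n)"

abbreviation cdom :: "('a, 'n::finite) chart \<Rightarrow> 'a set" where "cdom \<equiv> fst"

abbreviation cmap :: "('a, 'n::finite) chart \<Rightarrow> 'a \<Rightarrow> real^'n" where "cmap \<equiv> snd"

definition cinv :: "('a, 'n::finite) chart \<Rightarrow> real^'n \<Rightarrow> 'a" where
  "cinv c = inv_into (cdom c) (cmap c)"

definition is_chart :: "'a topology \<Rightarrow> ('a, 'n::finite) chart \<Rightarrow> bool" where
  "is_chart M c \<longleftrightarrow> openin M (cdom c) \<and> open (cmap c ` cdom c) \<and>
     homeomorphic_map (subtopology M (cdom c)) (top_of_set (cmap c ` cdom c)) (cmap c)"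

definition smooth_manifold :: "'a topology \<Rightarrow> ('a, 'n::finite) chart set \<Rightarrow> bool" where
  "smooth_manifold M A \<longleftrightarrow>
     Hausdorff_space M \<and> second_countable M \<and>
     (\<forall>c\<in>A. is_chart M c) \<and> (\<Union>c\<in>A. cdom c) = topspace M \<and>
     (\<forall>c\<in>A. \<forall>d\<in>A. smooth_on (cmap c ` (cdom c \<inter> cdom d)) (cmap d \<circ> cinv c))"

text \<open>Differential at \<open>p\<close> of the coordinate change from \<open>c\<close> to \<open>d\<close>.\<close>

definition dtrans :: "('a, 'n::finite) chart \<Rightarrow> ('a, 'n) chart \<Rightarrow> 'a \<Rightarrow> real^'n \<Rightarrow> real^'n" where
  "dtrans c d p = frechet_derivative (cmap d \<circ> cinv c) (at (cmap c p))"

text \<open>The orientation is the one for which all charts of the atlas are positive.\<close>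

definition oriented_manifold :: "'a topology \<Rightarrow> ('a, 'n::finite) chart set \<Rightarrow> bool" where
  "oriented_manifold M A \<longleftrightarrow> smooth_manifold M A \<and>
     (\<forall>c\<in>A. \<forall>d\<in>A. \<forall>p \<in> cdom c \<inter> cdom d. det (matrix (dtrans c d p)) > 0)"

definition smooth_fun :: "('a, 'n::finite) chart set \<Rightarrow> 'a set \<Rightarrow> ('a \<Rightarrow> real) \<Rightarrow> bool" where
  "smooth_fun A W f \<longleftrightarrow> (\<forall>c\<in>A. smooth_on (cmap c ` (cdom c \<inter> W)) (f \<circ> cinv c))"


section \<open>Tangent vectors and vector fields\<close>

text \<open>A tangent vector is the family of its component vectors with respect to the charts of the atlas
  around the base point, these being related by the differentials of the coordinate changes.
  Components with respect to all other charts are set to zero, so that \<open>tangent_space A p\<close> is the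
  vector space \<open>T\<^sub>pM\<close>.\<close>

datatype ('a, 'n::finite) tvec = TVec (comp: "('a, 'n) chart \<Rightarrow> real^'n")

instantiation tvec :: (type, finite) real_vector
begin

definition "0 = TVec (\<lambda>c. 0)"
definition "u + v = TVec (\<lambda>c. comp u c + comp v c)"
definition "u - v = TVec (\<lambda>c. comp u c - comp v c)"
definition "- v = TVec (\<lambda>c. - comp v c)"
definition "a *\<^sub>R v = TVec (\<lambda>c. a *\<^sub>R comp v c)"

instance
  by standard
    (simp_all add: zero_tvec_def plus_tvec_def minus_tvec_def uminus_tvec_def scaleR_tvec_def
      algebra_simps)

end

text \<open>Assembles components prescribed in the charts around \<open>p\<close>.\<close>

definition tvec_at ::
    "('a, 'n::finite) chart set \<Rightarrow> 'a \<Rightarrow> (('a, 'n) chart \<Rightarrow> real^'n) \<Rightarrow> ('a, 'n) tvec" where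
  "tvec_at A p w = TVec (\<lambda>c. if c \<in> A \<and> p \<in> cdom c then w c else 0)"

definition tangent_space :: "('a, 'n::finite) chart set \<Rightarrow> 'a \<Rightarrow> ('a, 'n) tvec set" where
  "tangent_space A p =
     {v. (\<forall>c\<in>A. \<forall>d\<in>A. p \<in> cdom c \<inter> cdom d \<longrightarrow> comp v d = dtrans c d p (comp v c)) \<and>
         (\<forall>c. c \<notin> A \<or> p \<notin> cdom c \<longrightarrow> comp v c = 0)}"

definition smooth_field ::
    "('a, 'n::finite) chart set \<Rightarrow> 'a set \<Rightarrow> ('a \<Rightarrow> ('a, 'n) tvec) \<Rightarrow> bool" where
  "smooth_field A W X \<longleftrightarrow> (\<forall>p\<in>W. X p \<in> tangent_space A p) \<and>
     (\<forall>c\<in>A. smooth_on (cmap c ` (cdom c \<inter> W)) (\<lambda>x. comp (X (cinv c x)) c))"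

definition chart_at :: "('a, 'n::finite) chart set \<Rightarrow> 'a \<Rightarrow> ('a, 'n) chart" where
  "chart_at A p = (SOME c. c \<in> A \<and> p \<in> cdom c)"

text \<open>The derivative \<open>v f\<close> of a function along \<open>v \<in> T\<^sub>pM\<close>; it does not depend on the chart used.\<close>

definition dir_deriv ::
    "('a, 'n::finite) chart set \<Rightarrow> 'a \<Rightarrow> ('a, 'n) tvec \<Rightarrow> ('a \<Rightarrow> real) \<Rightarrow> real" where
  "dir_deriv A p v f = (let c = chart_at A p in
     frechet_derivative (f \<circ> cinv c) (at (cmap c p)) (comp v c))"

text \<open>\<open>[X,Y]\<^sup>k = X\<^sup>i \<partial>\<^sub>iY\<^sup>k - Y\<^sup>i \<partial>\<^sub>iX\<^sup>k\<close> in every chart.\<close>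

definition lie_bracket ::
    "('a, 'n::finite) chart set \<Rightarrow> ('a \<Rightarrow> ('a, 'n) tvec) \<Rightarrow> ('a \<Rightarrow> ('a, 'n) tvec) \<Rightarrow> 'a \<Rightarrow> ('a, 'n) tvec"
  where
  "lie_bracket A X Y p = tvec_at A p (\<lambda>c.
     frechet_derivative (\<lambda>x. comp (Y (cinv c x)) c) (at (cmap c p)) (comp (X p) c) -
     frechet_derivative (\<lambda>x. comp (X (cinv c x)) c) (at (cmap c p)) (comp (Y p) c))"

text \<open>The vector field \<open>\<Sum>i. u\<^sub>i \<partial>\<^sub>i\<close> with constant components \<open>u\<close> in the chart \<open>c\<close>, on \<open>cdom c\<close>.\<close>

definition coord_field ::
    "('a, 'n::finite) chart set \<Rightarrow> ('a, 'n) chart \<Rightarrow> real^'n \<Rightarrow> 'a \<Rightarrow> ('a, 'n) tvec" where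
  "coord_field A c u p = (if p \<in> cdom c then tvec_at A p (\<lambda>d. dtrans c d p u) else 0)"


section \<open>Riemannian metrics, the Levi-Civita connection and curvature\<close>

definition riemannian_metric ::
    "'a topology \<Rightarrow> ('a, 'n::finite) chart set \<Rightarrow> ('a \<Rightarrow> ('a, 'n) tvec \<Rightarrow> ('a, 'n) tvec \<Rightarrow> real) \<Rightarrow> bool"
  where
  "riemannian_metric M A g \<longleftrightarrow>
     (\<forall>p \<in> topspace M. \<forall>u \<in> tangent_space A p. \<forall>v \<in> tangent_space A p.
        g p u v = g p v u \<and> (u \<noteq> 0 \<longrightarrow> g p u u > 0) \<and>
        (\<forall>w \<in> tangent_space A p. \<forall>a b. g p (a *\<^sub>R u + b *\<^sub>R v) w = a * g p u w + b * g p v w)) \<and>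
     (\<forall>W X Y. openin M W \<longrightarrow> smooth_field A W X \<longrightarrow> smooth_field A W Y \<longrightarrow>
        smooth_fun A W (\<lambda>p. g p (X p) (Y p)))"

text \<open>\<open>D p v Y\<close> is \<open>\<nabla>\<^sub>vY\<close> for \<open>v \<in> T\<^sub>pM\<close> and \<open>Y\<close> a smooth vector field on an open neighbourhood \<open>W\<close>
  of \<open>p\<close>.  A connection on globally defined vector fields is local and tensorial in the direction
  and therefore extends uniquely to an operator of this kind.\<close>

type_synonym ('a, 'n) conn =
  "'a \<Rightarrow> ('a, 'n) tvec \<Rightarrow> ('a \<Rightarrow> ('a, 'n) tvec) \<Rightarrow> ('a, 'n) tvec"

definition affine_connection ::
    "'a topology \<Rightarrow> ('a, 'n::finite) chart set \<Rightarrow> ('a, 'n) conn \<Rightarrow> bool" where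
  "affine_connection M A D \<longleftrightarrow> (\<forall>W. openin M W \<longrightarrow>
     (\<forall>Y. smooth_field A W Y \<longrightarrow>
       (\<forall>p\<in>W. \<forall>u \<in> tangent_space A p. \<forall>v \<in> tangent_space A p.
          D p u Y \<in> tangent_space A p \<and>
          (\<forall>a b. D p (a *\<^sub>R u + b *\<^sub>R v) Y = a *\<^sub>R D p u Y + b *\<^sub>R D p v Y)) \<and>
       (\<forall>Z. smooth_field A W Z \<longrightarrow> (\<forall>p\<in>W. \<forall>v \<in> tangent_space A p.
          D p v (\<lambda>q. Y q + Z q) = D p v Y + D p v Z)) \<and>
       (\<forall>f. smooth_fun A W f \<longrightarrow> (\<forall>p\<in>W. \<forall>v \<in> tangent_space A p.
          D p v (\<lambda>q. f q *\<^sub>R Y q) = f p *\<^sub>R D p v Y + dir_deriv A p v f *\<^sub>R Y p)) \<and>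
       (\<forall>Z. (\<forall>q\<in>W. Z q = Y q) \<longrightarrow> (\<forall>p\<in>W. \<forall>v \<in> tangent_space A p. D p v Z = D p v Y)) \<and>
       (\<forall>X. smooth_field A W X \<longrightarrow> smooth_field A W (\<lambda>p. D p (X p) Y))))"

definition levi_civita ::
    "'a topology \<Rightarrow> ('a, 'n::finite) chart set \<Rightarrow>
     ('a \<Rightarrow> ('a, 'n) tvec \<Rightarrow> ('a, 'n) tvec \<Rightarrow> real) \<Rightarrow> ('a, 'n) conn \<Rightarrow> bool" where
  "levi_civita M A g D \<longleftrightarrow> affine_connection M A D \<and>
     (\<forall>W X Y. openin M W \<longrightarrow> smooth_field A W X \<longrightarrow> smooth_field A W Y \<longrightarrow>
        (\<forall>p\<in>W. D p (X p) Y - D p (Y p) X = lie_bracket A X Y p) \<and>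
        (\<forall>p\<in>W. \<forall>v \<in> tangent_space A p.
           dir_deriv A p v (\<lambda>q. g q (X q) (Y q)) = g p (D p v X) (Y p) + g p (X p) (D p v Y)))"

definition curv_field ::
    "('a, 'n::finite) chart set \<Rightarrow> ('a, 'n) conn \<Rightarrow> ('a \<Rightarrow> ('a, 'n) tvec) \<Rightarrow> ('a \<Rightarrow> ('a, 'n) tvec) \<Rightarrow>
     ('a \<Rightarrow> ('a, 'n) tvec) \<Rightarrow> 'a \<Rightarrow> ('a, 'n) tvec" where
  "curv_field A D X Y Z p =
     D p (X p) (\<lambda>q. D q (Y q) Z) - D p (Y p) (\<lambda>q. D q (X q) Z) - D p (lie_bracket A X Y p) Z"

text \<open>\<open>R(x,y)z\<close> for tangent vectors at \<open>p\<close>: extend \<open>x, y, z\<close> to vector fields near \<open>p\<close>, here with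
  constant components in some chart.  As \<open>curv_field\<close> is tensorial, any other extension gives the
  same value.\<close>

definition curv ::
    "('a, 'n::finite) chart set \<Rightarrow> ('a, 'n) conn \<Rightarrow> 'a \<Rightarrow> ('a, 'n) tvec \<Rightarrow> ('a, 'n) tvec \<Rightarrow>
     ('a, 'n) tvec \<Rightarrow> ('a, 'n) tvec" where
  "curv A D p x y z = (let c = chart_at A p; ext = (\<lambda>v. coord_field A c (comp v c)) in
     curv_field A D (ext x) (ext y) (ext z) p)"

text \<open>Sign and order convention: \<open>R(X,Y,Z,W) = \<langle>R(X,Y)W,Z\<rangle>\<close>.\<close>

definition curv4 ::
    "('a, 'n::finite) chart set \<Rightarrow> ('a \<Rightarrow> ('a, 'n) tvec \<Rightarrow> ('a, 'n) tvec \<Rightarrow> real) \<Rightarrow> ('a, 'n) conn \<Rightarrow>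
     'a \<Rightarrow> ('a, 'n) tvec \<Rightarrow> ('a, 'n) tvec \<Rightarrow> ('a, 'n) tvec \<Rightarrow> ('a, 'n) tvec \<Rightarrow> real" where
  "curv4 A g D p x y z w = g p (curv A D p x y w) z"


section \<open>Curves and vector fields along curves\<close>

text \<open>A vector field along \<open>\<gamma>\<close> is a map \<open>V\<close> with \<open>V t \<in> T\<^bsub>\<gamma> t\<^esub>M\<close> for \<open>t \<in> I\<close>; its values outside
  \<open>I\<close> are irrelevant.\<close>

definition smooth_curve ::
    "'a topology \<Rightarrow> ('a, 'n::finite) chart set \<Rightarrow> real set \<Rightarrow> (real \<Rightarrow> 'a) \<Rightarrow> bool" where
  "smooth_curve M A I \<gamma> \<longleftrightarrow>
     is_interval I \<and> interior I \<noteq> {} \<and> continuous_map (top_of_set I) M \<gamma> \<and>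
     (\<forall>c\<in>A. \<forall>t\<in>I. \<gamma> t \<in> cdom c \<longrightarrow>
        (\<forall>k. nth_deriv_within I k (\<lambda>s. cmap c (\<gamma> s)) differentiable (at t within I)))"

definition velocity ::
    "('a, 'n::finite) chart set \<Rightarrow> real set \<Rightarrow> (real \<Rightarrow> 'a) \<Rightarrow> real \<Rightarrow> ('a, 'n) tvec" where
  "velocity A I \<gamma> t =
     tvec_at A (\<gamma> t) (\<lambda>c. vector_derivative (\<lambda>s. cmap c (\<gamma> s)) (at t within I))"

definition smooth_field_along ::
    "('a, 'n::finite) chart set \<Rightarrow> real set \<Rightarrow> (real \<Rightarrow> 'a) \<Rightarrow> (real \<Rightarrow> ('a, 'n) tvec) \<Rightarrow> bool" where
  "smooth_field_along A I \<gamma> V \<longleftrightarrow> (\<forall>t\<in>I. V t \<in> tangent_space A (\<gamma> t) \<and>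
     (\<forall>c\<in>A. \<gamma> t \<in> cdom c \<longrightarrow>
        (\<forall>k. nth_deriv_within I k (\<lambda>s. comp (V s) c) differentiable (at t within I))))"

text \<open>The induced covariant derivative \<open>\<nabla>\<^sub>TV\<close> along \<open>\<gamma>\<close>.  With \<open>V = \<Sum>j. V\<^sup>j \<partial>\<^sub>j\<close> in a chart it is
  \<open>\<Sum>j. (V\<^sup>j)' \<partial>\<^sub>j + V\<^sup>j \<nabla>\<^sub>T\<partial>\<^sub>j\<close>; the second part is the derivative in direction \<open>T\<close> of the vector
  field with constant components \<open>V\<^sup>j(t)\<close>.\<close>

definition cov_deriv ::
    "('a, 'n::finite) chart set \<Rightarrow> ('a, 'n) conn \<Rightarrow> real set \<Rightarrow> (real \<Rightarrow> 'a) \<Rightarrow>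
     (real \<Rightarrow> ('a, 'n) tvec) \<Rightarrow> real \<Rightarrow> ('a, 'n) tvec" where
  "cov_deriv A D I \<gamma> V t = tvec_at A (\<gamma> t) (\<lambda>c.
     vector_derivative (\<lambda>s. comp (V s) c) (at t within I) +
     comp (D (\<gamma> t) (velocity A I \<gamma> t) (coord_field A c (comp (V t) c))) c)"

abbreviation cov_deriv_pow_T ::
    "('a, 'n::finite) chart set \<Rightarrow> ('a, 'n) conn \<Rightarrow> real set \<Rightarrow> (real \<Rightarrow> 'a) \<Rightarrow> nat \<Rightarrow>
     real \<Rightarrow> ('a, 'n) tvec" where
  "cov_deriv_pow_T A D I \<gamma> k \<equiv> (cov_deriv A D I \<gamma> ^^ k) (velocity A I \<gamma>)"

definition unit_speed_curve ::
    "'a topology \<Rightarrow> ('a, 'n::finite) chart set \<Rightarrow>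
     ('a \<Rightarrow> ('a, 'n) tvec \<Rightarrow> ('a, 'n) tvec \<Rightarrow> real) \<Rightarrow> real set \<Rightarrow> (real \<Rightarrow> 'a) \<Rightarrow> bool" where
  "unit_speed_curve M A g I \<gamma> \<longleftrightarrow> smooth_curve M A I \<gamma> \<and>
     (\<forall>t\<in>I. g (\<gamma> t) (velocity A I \<gamma> t) (velocity A I \<gamma> t) = 1)"

definition geodesic ::
    "('a, 'n::finite) chart set \<Rightarrow> ('a, 'n) conn \<Rightarrow> real set \<Rightarrow> (real \<Rightarrow> 'a) \<Rightarrow> bool" where
  "geodesic A D I \<gamma> \<longleftrightarrow> (\<forall>t\<in>I. cov_deriv A D I \<gamma> (velocity A I \<gamma>) t = 0)"

definition tension ::
    "('a, 'n::finite) chart set \<Rightarrow> ('a, 'n) conn \<Rightarrow> real set \<Rightarrow> nat \<Rightarrow> (real \<Rightarrow> 'a) \<Rightarrow>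
     real \<Rightarrow> ('a, 'n) tvec" where
  "tension A D I r \<gamma> t =
     cov_deriv_pow_T A D I \<gamma> (2 * r - 1) t +
     (\<Sum>l = 0..r - 2. (-1) ^ l *\<^sub>R
        curv A D (\<gamma> t) (cov_deriv_pow_T A D I \<gamma> (2 * r - 3 - l) t)
                         (cov_deriv_pow_T A D I \<gamma> l t) (velocity A I \<gamma> t))"

definition r_harmonic ::
    "'a topology \<Rightarrow> ('a, 'n::finite) chart set \<Rightarrow>
     ('a \<Rightarrow> ('a, 'n) tvec \<Rightarrow> ('a, 'n) tvec \<Rightarrow> real) \<Rightarrow> ('a, 'n) conn \<Rightarrow>
     real set \<Rightarrow> nat \<Rightarrow> (real \<Rightarrow> 'a) \<Rightarrow> bool" where
  "r_harmonic M A g D I r \<gamma> \<longleftrightarrow>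
     unit_speed_curve M A g I \<gamma> \<and> (\<forall>t\<in>I. tension A D I r \<gamma> t = 0)"

definition proper_r_harmonic ::
    "'a topology \<Rightarrow> ('a, 'n::finite) chart set \<Rightarrow>
     ('a \<Rightarrow> ('a, 'n) tvec \<Rightarrow> ('a, 'n) tvec \<Rightarrow> real) \<Rightarrow> ('a, 'n) conn \<Rightarrow>
     real set \<Rightarrow> nat \<Rightarrow> (real \<Rightarrow> 'a) \<Rightarrow> bool" where
  "proper_r_harmonic M A g D I r \<gamma> \<longleftrightarrow> r_harmonic M A g D I r \<gamma> \<and> \<not> geodesic A D I \<gamma>"

text \<open>Positivity of the ordered pair \<open>(u, v)\<close> in dimension two.  The order on the index type fixes
  which of the two coordinates is the first one.\<close>

definition positively_oriented_pair ::
    "('a, 'n::{finite,linorder}) chart set \<Rightarrow> 'a \<Rightarrow> ('a, 'n) tvec \<Rightarrow> ('a, 'n) tvec \<Rightarrow> bool" where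
  "positively_oriented_pair A p u v \<longleftrightarrow> (\<forall>c\<in>A. p \<in> cdom c \<longrightarrow>
     det (\<chi> i. if i = Min UNIV then comp u c else comp v c) > 0)"

text \<open>In dimension two \<open>\<kappa>\<close> is the signed curvature, and \<open>\<kappa> = 0\<close> (a geodesic) is allowed.\<close>

definition frenet_helix2 ::
    "'a topology \<Rightarrow> ('a, 'n::{finite,linorder}) chart set \<Rightarrow>
     ('a \<Rightarrow> ('a, 'n) tvec \<Rightarrow> ('a, 'n) tvec \<Rightarrow> real) \<Rightarrow> ('a, 'n) conn \<Rightarrow>
     real set \<Rightarrow> (real \<Rightarrow> 'a) \<Rightarrow> (real \<Rightarrow> ('a, 'n) tvec) \<Rightarrow> real \<Rightarrow> bool" where
  "frenet_helix2 M A g D I \<gamma> N \<kappa> \<longleftrightarrow>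
     unit_speed_curve M A g I \<gamma> \<and> smooth_field_along A I \<gamma> N \<and>
     (let T = velocity A I \<gamma> in
       (\<forall>t\<in>I. g (\<gamma> t) (N t) (N t) = 1 \<and> g (\<gamma> t) (T t) (N t) = 0 \<and>
          cov_deriv A D I \<gamma> T t = \<kappa> *\<^sub>R N t \<and>
          cov_deriv A D I \<gamma> N t = - \<kappa> *\<^sub>R T t) \<and>
       (CARD('n) \<ge> 3 \<longrightarrow> \<kappa> > 0) \<and>
       (CARD('n) = 2 \<longrightarrow> (\<forall>t\<in>I. positively_oriented_pair A (\<gamma> t) (T t) (N t))))"

end

theory Submission
  imports Defs
begin

text \<open>
  The Frenet equations give \<open>\<nabla>\<^bsup>2k\<^esup>T = (-1)\<^bsup>k\<^esup>\<kappa>\<^bsup>2k\<^esup>T\<close> and \<open>\<nabla>\<^bsup>2k+1\<^esup>T = (-1)\<^bsup>k\<^esup>\<kappa>\<^bsup>2k+1\<^esup>N\<close>.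
  All \<open>r - 1\<close> curvature terms of \<open>\<tau>\<^sub>r(\<gamma>)\<close> therefore coincide, and
  \<open>\<tau>\<^sub>r(\<gamma>) = (-1)\<^bsup>r-1\<^esup>\<kappa>\<^bsup>2r-3\<^esup>(\<kappa>\<^sup>2N - (r - 1)R(N,T)T)\<close>.  The vector \<open>R(N,T)T\<close> is a multiple
  of \<open>N\<close>: it has no component orthogonal to \<open>T\<close> and \<open>N\<close> by hypothesis, and none along \<open>T\<close>
  because \<open>\<langle>R(X,Y)Z,Z\<rangle> = 0\<close>.
\<close>

section \<open>Calculus of smooth maps\<close>

text \<open>The connection is known only through its axioms, so \<langle>R(X,Y)Z,Z\<rangle> = 0 has
  to come from metric compatibility and from the symmetry of the second derivatives of
  \<langle>Z,Z\<rangle> in a chart. Since \<open>Ck_on\<close> is phrased by iterated directional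
  derivatives, this symmetry and the closure rules for smooth maps are derived for that notion.
  \<open>curv\<close> extends vectors with constant components in a chosen chart; such fields have
  vanishing Lie bracket, and R(X,Y)Z becomes a difference of two second covariant derivatives. The
  summands of the tension agree because an odd index interchanges the roles of T and N, and the sign
  from antisymmetry of R cancels the sign of the summand. When \<kappa> is nonzero, the prefactor
  \<kappa>^(2r-3) can be cancelled; when \<kappa> = 0, the curve is a geodesic and thus not
  proper.\<close>

lemma Ck_on_cong:
  assumes "open S" "Ck_on k S f" "\<And>x. x \<in> S \<Longrightarrow> f x = g x"
  shows "Ck_on k S g"
  using assms(2,3)
proof (induction k arbitrary: f g)
  case 0
  then show ?case by (auto cong: continuous_on_cong)
next
  case (Suc k)
  have diff: "g differentiable (at x)" if "x \<in> S" for x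
    using Suc.prems that assms(1) unfolding differentiable_def
    by (metis Ck_on.simps(2) differentiable_def has_derivative_transform_within_open)
  have deriv: "frechet_derivative f (at x) = frechet_derivative g (at x)" if "x \<in> S" for x
    using Suc.prems that assms(1) by (auto intro: frechet_derivative_transform_within_open)
  have "Ck_on k S (\<lambda>x. frechet_derivative g (at x) v)" for v
    by (rule Suc.IH[of "\<lambda>x. frechet_derivative f (at x) v"], insert Suc.prems(1) deriv) auto
  with diff show ?case by simp
qed

lemma Ck_on_Suc_imp_Ck_on: "Ck_on (Suc k) S f \<Longrightarrow> Ck_on k S f"
proof (induction k arbitrary: f)
  case 0
  then show ?case
    by (simp add: continuous_at_imp_continuous_on differentiable_imp_continuous_within)
qed auto

lemma Ck_on_const: "Ck_on k S (\<lambda>x. c)"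
  by (induction k arbitrary: c) auto

lemma Ck_on_add:
  assumes "open S" "Ck_on k S f" "Ck_on k S g"
  shows "Ck_on k S (\<lambda>x. f x + g x)"
  using assms(2,3)
proof (induction k arbitrary: f g)
  case 0
  then show ?case by (auto intro: continuous_intros)
next
  case (Suc k)
  have D: "frechet_derivative (\<lambda>x. f x + g x) (at x) =
      (\<lambda>v. frechet_derivative f (at x) v + frechet_derivative g (at x) v)" if "x \<in> S" for x
    using Suc.prems that
    by (intro frechet_derivative_at[symmetric] has_derivative_add)
      (auto simp: frechet_derivative_works[symmetric])
  have "Ck_on k S (\<lambda>x. frechet_derivative (\<lambda>x. f x + g x) (at x) v)" for v
    by (rule Ck_on_cong[OF assms(1),
          of k "\<lambda>x. frechet_derivative f (at x) v + frechet_derivative g (at x) v"],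
        insert Suc.prems D Suc.IH) auto
  with Suc.prems show ?case by auto
qed

lemma Ck_on_sum:
  assumes "open S" "\<And>i. i \<in> J \<Longrightarrow> Ck_on k S (f i)"
  shows "Ck_on k S (\<lambda>x. \<Sum>i\<in>J. f i x)"
  using assms(2)
  by (induction J rule: infinite_finite_induct) (auto intro: Ck_on_const Ck_on_add[OF assms(1)])

lemma Ck_on_bounded_linear:
  assumes "open S" "bounded_linear L" "Ck_on k S f"
  shows "Ck_on k S (\<lambda>x. L (f x))"
  using assms(3)
proof (induction k arbitrary: f)
  case 0
  then show ?case by (auto intro: bounded_linear.continuous_on[OF assms(2)])
next
  case (Suc k)
  have hd: "((\<lambda>x. L (f x)) has_derivative (\<lambda>v. L (frechet_derivative f (at x) v))) (at x)"
    if "x \<in> S" for x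
    using Suc.prems that
    by (intro bounded_linear.has_derivative[OF assms(2)])
      (auto simp: frechet_derivative_works[symmetric])
  have "Ck_on k S (\<lambda>x. frechet_derivative (\<lambda>x. L (f x)) (at x) v)" for v
    by (rule Ck_on_cong[OF assms(1), of k "\<lambda>x. L (frechet_derivative f (at x) v)"],
        insert Suc.prems Suc.IH frechet_derivative_at[OF hd]) (auto simp: fun_eq_iff)
  with hd show ?case by (auto simp: differentiable_def)
qed

text \<open>The product rule pairs each factor with the derivative of the other, so the induction
  generalizes over both factors. The undifferentiated factor is only needed at order
  \<open>k\<close>, which \<open>Ck_on_Suc_imp_Ck_on\<close> supplies.\<close>

lemma Ck_on_scaleR:
  fixes f :: "real^'n \<Rightarrow> real" and h :: "real^'n \<Rightarrow> 'b::real_normed_vector"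
  assumes "open S" "Ck_on k S f" "Ck_on k S h"
  shows "Ck_on k S (\<lambda>x. f x *\<^sub>R h x)"
  using assms(2,3)
proof (induction k arbitrary: f h)
  case 0
  then show ?case by (auto intro: continuous_intros)
next
  case (Suc k)
  have hd: "((\<lambda>x. f x *\<^sub>R h x) has_derivative
      (\<lambda>v. f x *\<^sub>R frechet_derivative h (at x) v + frechet_derivative f (at x) v *\<^sub>R h x)) (at x)"
    if "x \<in> S" for x
    using Suc.prems that
    by (intro has_derivative_scaleR) (auto simp: frechet_derivative_works[symmetric])
  have "Ck_on k S (\<lambda>x. frechet_derivative (\<lambda>x. f x *\<^sub>R h x) (at x) v)" for v
  proof (rule Ck_on_cong[OF assms(1)])
    show "Ck_on k S (\<lambda>x. f x *\<^sub>R frechet_derivative h (at x) v + frechet_derivative f (at x) v *\<^sub>R h x)"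
      using Suc.prems Suc.prems[THEN Ck_on_Suc_imp_Ck_on]
      by (intro Ck_on_add[OF assms(1)] Suc.IH) auto
  qed (use frechet_derivative_at[OF hd] in \<open>auto simp: fun_eq_iff\<close>)
  with hd show ?case by (auto simp: differentiable_def)
qed

text \<open>The chain rule evaluates the derivative of \<open>f\<close> in a direction that varies
  with \<open>x\<close>, whereas \<open>Ck_on\<close> controls only fixed directions. Expanding the
  direction in the standard basis leaves products of components of the derivative of
  \<open>h\<close> with directional derivatives of \<open>f\<close> at \<open>h x\<close>, to which
  the induction hypothesis applies.\<close>

lemma Ck_on_compose:
  fixes h :: "real^'n \<Rightarrow> real^'m" and f :: "real^'m \<Rightarrow> 'b::real_normed_vector"
  assumes "open S" "Ck_on k S h" "h ` S \<subseteq> U" "Ck_on k U f"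
  shows "Ck_on k S (\<lambda>x. f (h x))"
  using assms(2,4)
proof (induction k arbitrary: f)
  case 0
  with assms(3) show ?case by (auto intro: continuous_on_compose2)
next
  case (Suc k)
  have diff: "f differentiable (at (h x))" "h differentiable (at x)" if "x \<in> S" for x
    using Suc.prems that assms(3) by auto
  have hd: "((\<lambda>x. f (h x)) has_derivative
      (\<lambda>v. frechet_derivative f (at (h x)) (frechet_derivative h (at x) v))) (at x)"
    if "x \<in> S" for x
    using diff[OF that] diff_chain_at unfolding frechet_derivative_works o_def by blast
  have expand: "frechet_derivative (\<lambda>x. f (h x)) (at x) v = (\<Sum>i\<in>UNIV.
      (frechet_derivative h (at x) v $ i) *\<^sub>R frechet_derivative f (at (h x)) (axis i 1))"
    if "x \<in> S" for x v
  proof -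
    let ?w = "frechet_derivative h (at x) v"
    interpret linear "frechet_derivative f (at (h x))"
      using diff[OF that] by (simp add: linear_frechet_derivative)
    have "frechet_derivative (\<lambda>x. f (h x)) (at x) v = frechet_derivative f (at (h x)) ?w"
      using frechet_derivative_at[OF hd[OF that]] by (simp add: fun_eq_iff)
    also have "?w = (\<Sum>i\<in>UNIV. (?w $ i) *\<^sub>R axis i 1)"
      by (simp add: basis_expansion scalar_mult_eq_scaleR[symmetric])
    finally show ?thesis by (simp only: sum scale)
  qed
  have "Ck_on k S (\<lambda>x. frechet_derivative (\<lambda>x. f (h x)) (at x) v)" for v
  proof (rule Ck_on_cong[OF assms(1)])
    show "Ck_on k S (\<lambda>x. \<Sum>i\<in>UNIV.
        (frechet_derivative h (at x) v $ i) *\<^sub>R frechet_derivative f (at (h x)) (axis i 1))"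
      using Suc.prems Suc.prems(1)[THEN Ck_on_Suc_imp_Ck_on]
      by (intro Ck_on_sum Ck_on_scaleR assms(1) Suc.IH
          Ck_on_bounded_linear[OF assms(1) bounded_linear_vec_nth]) auto
  qed (simp add: expand)
  with hd show ?case by (auto simp: differentiable_def)
qed

lemma smooth_on_const: "smooth_on S (\<lambda>x. c)"
  by (simp add: smooth_on_def Ck_on_const)

lemma smooth_on_cong:
  "open S \<Longrightarrow> smooth_on S f \<Longrightarrow> (\<And>x. x \<in> S \<Longrightarrow> f x = g x) \<Longrightarrow> smooth_on S g"
  unfolding smooth_on_def using Ck_on_cong by blast

lemma smooth_on_compose:
  "open S \<Longrightarrow> smooth_on S h \<Longrightarrow> h ` S \<subseteq> U \<Longrightarrow> smooth_on U f \<Longrightarrow> smooth_on S (\<lambda>x. f (h x))"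
  unfolding smooth_on_def by (blast intro: Ck_on_compose)

lemma smooth_on_imp_differentiable: "smooth_on S f \<Longrightarrow> x \<in> S \<Longrightarrow> f differentiable (at x)"
  unfolding smooth_on_def using Ck_on.simps(2) by blast

lemma smooth_on_frechet_derivative:
  "smooth_on S f \<Longrightarrow> smooth_on S (\<lambda>x. frechet_derivative f (at x) v)"
  unfolding smooth_on_def using Ck_on.simps(2) by blast

section \<open>Symmetry of mixed second derivatives\<close>

lemma directional_mean_value:
  fixes F :: "'b::real_normed_vector \<Rightarrow> real"
  assumes "0 < h" "\<And>s. 0 \<le> s \<Longrightarrow> s \<le> h \<Longrightarrow> F differentiable (at (x + s *\<^sub>R w))"
  shows "\<exists>s. 0 < s \<and> s < h \<and>
    F (x + h *\<^sub>R w) - F x = h * frechet_derivative F (at (x + s *\<^sub>R w)) w"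
proof -
  have "((\<lambda>s. F (x + s *\<^sub>R w)) has_real_derivative
      frechet_derivative F (at (x + s *\<^sub>R w)) w) (at s)" if "0 \<le> s" "s \<le> h" for s
  proof -
    let ?F' = "frechet_derivative F (at (x + s *\<^sub>R w))"
    have "((\<lambda>s. x + s *\<^sub>R w) has_derivative (\<lambda>r. r *\<^sub>R w)) (at s)"
      by (auto intro!: derivative_eq_intros)
    then have "((\<lambda>s. F (x + s *\<^sub>R w)) has_derivative (\<lambda>r. ?F' (r *\<^sub>R w))) (at s)"
      using assms(2)[OF that] diff_chain_at unfolding frechet_derivative_works o_def by blast
    moreover have "(\<lambda>r. ?F' (r *\<^sub>R w)) = (*) (?F' w)"
      using linear_scale[OF linear_frechet_derivative[OF assms(2)[OF that]]] by (auto simp: mult.commute)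
    ultimately show ?thesis by (simp add: has_field_derivative_def)
  qed
  from MVT2[OF assms(1) this] show ?thesis by auto
qed

text \<open>Two applications of the mean value theorem: along \<open>u\<close> to the difference of
  \<open>F\<close> in direction \<open>v\<close>, then along \<open>v\<close> to the derivative of
  \<open>F\<close> in direction \<open>u\<close>. The left-hand side is symmetric in
  \<open>u\<close> and \<open>v\<close>, the right-hand side is not visibly so; this is what yields
  the symmetry of second derivatives.\<close>

lemma second_difference_mean_value:
  fixes F :: "'b::real_normed_vector \<Rightarrow> real"
  assumes h: "0 < h"
    and F: "\<And>x. x \<in> S \<Longrightarrow> F differentiable (at x)"
    and F': "\<And>x. x \<in> S \<Longrightarrow> (\<lambda>x. frechet_derivative F (at x) u) differentiable (at x)"
    and S: "\<And>s t. 0 \<le> s \<Longrightarrow> s \<le> h \<Longrightarrow> 0 \<le> t \<Longrightarrow> t \<le> h \<Longrightarrow> x + s *\<^sub>R u + t *\<^sub>R v \<in> S"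
  shows "\<exists>s t. 0 < s \<and> s < h \<and> 0 < t \<and> t < h \<and>
    F (x + h *\<^sub>R u + h *\<^sub>R v) - F (x + h *\<^sub>R u) - F (x + h *\<^sub>R v) + F x =
    h\<^sup>2 * frechet_derivative (\<lambda>x. frechet_derivative F (at x) u) (at (x + s *\<^sub>R u + t *\<^sub>R v)) v"
proof -
  let ?G = "\<lambda>x. F (x + h *\<^sub>R v) - F x"
  let ?F' = "\<lambda>x. frechet_derivative F (at x) u"
  have G: "(?G has_derivative (\<lambda>w. frechet_derivative F (at (x + s *\<^sub>R u + h *\<^sub>R v)) w -
      frechet_derivative F (at (x + s *\<^sub>R u)) w)) (at (x + s *\<^sub>R u))" if s: "0 \<le> s" "s \<le> h" for s
  proof (rule has_derivative_diff)
    have "x + s *\<^sub>R u + h *\<^sub>R v \<in> S" using S s h by simp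
    then have "(F has_derivative frechet_derivative F (at (x + s *\<^sub>R u + h *\<^sub>R v)))
        (at (x + s *\<^sub>R u + h *\<^sub>R v))"
      using F by (simp add: frechet_derivative_works[symmetric])
    moreover have "((\<lambda>x. x + h *\<^sub>R v) has_derivative (\<lambda>w. w)) (at (x + s *\<^sub>R u))"
      by (auto intro!: derivative_eq_intros)
    ultimately show "((\<lambda>x. F (x + h *\<^sub>R v)) has_derivative
        frechet_derivative F (at (x + s *\<^sub>R u + h *\<^sub>R v))) (at (x + s *\<^sub>R u))"
      by (rule has_derivative_compose[rotated])
    have "x + s *\<^sub>R u \<in> S" using S[of s 0] s h by simp
    then show "(F has_derivative frechet_derivative F (at (x + s *\<^sub>R u))) (at (x + s *\<^sub>R u))"
      using F by (simp add: frechet_derivative_works[symmetric])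
  qed
  have "\<exists>s. 0 < s \<and> s < h \<and> ?G (x + h *\<^sub>R u) - ?G x = h * frechet_derivative ?G (at (x + s *\<^sub>R u)) u"
    using G h by (intro directional_mean_value) (auto simp: differentiable_def)
  then obtain s where s: "0 < s" "s < h"
    and 1: "?G (x + h *\<^sub>R u) - ?G x = h * (?F' (x + s *\<^sub>R u + h *\<^sub>R v) - ?F' (x + s *\<^sub>R u))"
    using frechet_derivative_at[OF G] by (auto simp: fun_eq_iff)
  have "\<exists>t. 0 < t \<and> t < h \<and> ?F' (x + s *\<^sub>R u + h *\<^sub>R v) - ?F' (x + s *\<^sub>R u) =
      h * frechet_derivative ?F' (at (x + s *\<^sub>R u + t *\<^sub>R v)) v"
    using F' S s h by (intro directional_mean_value) auto
  then obtain t where t: "0 < t" "t < h"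
    and 2: "?F' (x + s *\<^sub>R u + h *\<^sub>R v) - ?F' (x + s *\<^sub>R u) =
      h * frechet_derivative ?F' (at (x + s *\<^sub>R u + t *\<^sub>R v)) v"
    by blast
  have "F (x + h *\<^sub>R u + h *\<^sub>R v) - F (x + h *\<^sub>R u) - F (x + h *\<^sub>R v) + F x =
      h\<^sup>2 * frechet_derivative ?F' (at (x + s *\<^sub>R u + t *\<^sub>R v)) v"
    using 1[unfolded 2] unfolding power2_eq_square mult.assoc by linarith
  with s t show ?thesis by blast
qed

text \<open>Both orders of differentiation represent the same second difference over a small
  parallelogram, so the two mixed derivatives agree at two possibly different points near
  \<open>x\<close>. Continuity moves both values to \<open>x\<close> at a cost below any
  \<open>e\<close>.\<close>

lemma second_derivative_symmetric:
  fixes F :: "real^'n \<Rightarrow> real"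
  assumes "open S" "x \<in> S" "Ck_on 2 S F"
  shows "frechet_derivative (\<lambda>x. frechet_derivative F (at x) u) (at x) v =
    frechet_derivative (\<lambda>x. frechet_derivative F (at x) v) (at x) u"
proof -
  let ?H = "\<lambda>u v x. frechet_derivative (\<lambda>x. frechet_derivative F (at x) u) (at x) v"
  have F: "F differentiable (at y)" "(\<lambda>x. frechet_derivative F (at x) u) differentiable (at y)"
    "continuous_on S (?H u v)" if "y \<in> S" for y u v
    using assms(3) that by (auto simp: numeral_2_eq_2)
  have "\<bar>?H u v x - ?H v u x\<bar> < e" if "0 < e" for e
  proof -
    have "\<exists>d>0. \<forall>y\<in>S. dist y x < d \<longrightarrow> dist (?H u v y) (?H u v x) < e / 2" for u v
      using F(3)[OF assms(2)] assms(2) \<open>0 < e\<close> unfolding continuous_on_iff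
      by (meson half_gt_zero)
    then obtain d1 d2 where d: "d1 > 0" "d2 > 0"
      "\<And>y. y \<in> S \<Longrightarrow> dist y x < d1 \<Longrightarrow> dist (?H u v y) (?H u v x) < e / 2"
      "\<And>y. y \<in> S \<Longrightarrow> dist y x < d2 \<Longrightarrow> dist (?H v u y) (?H v u x) < e / 2"
      by metis
    obtain d3 where d3: "d3 > 0" "\<And>y. dist y x < d3 \<Longrightarrow> y \<in> S"
      using assms(1,2) unfolding open_dist by blast
    define d0 where "d0 = min d1 (min d2 d3)"
    \<comment> \<open>This size keeps the whole parallelogram within distance \<open>d0\<close> of
      \<open>x\<close>; the summand 1 makes the bound strict and avoids a zero denominator when
      \<open>u\<close> and \<open>v\<close> both vanish.\<close>
    define h where "h = d0 / (norm u + norm v + 1)"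
    have d0: "d0 > 0" using d d3 by (simp add: d0_def)
    have pos: "norm u + norm v + 1 > 0" by (simp add: add_nonneg_pos)
    then have h: "h > 0" using d0 by (simp add: h_def)
    have small: "dist (x + s *\<^sub>R u + t *\<^sub>R v) x < d0"
      if "0 \<le> s" "s \<le> h" "0 \<le> t" "t \<le> h" for s t
    proof -
      have "dist (x + s *\<^sub>R u + t *\<^sub>R v) x \<le> s * norm u + t * norm v"
        using norm_triangle_ineq[of "s *\<^sub>R u" "t *\<^sub>R v"] that by (simp add: dist_norm)
      also have "\<dots> \<le> h * norm u + h * norm v"
        using that by (intro add_mono mult_right_mono) auto
      also have "\<dots> < h * (norm u + norm v + 1)" using h by (simp add: algebra_simps)
      also have "\<dots> = d0" using pos by (simp add: h_def)
      finally show ?thesis .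
    qed
    have near: "x + s *\<^sub>R u + t *\<^sub>R v \<in> S" "dist (x + s *\<^sub>R u + t *\<^sub>R v) x < d1"
      "dist (x + s *\<^sub>R u + t *\<^sub>R v) x < d2" if "0 \<le> s" "s \<le> h" "0 \<le> t" "t \<le> h" for s t
      using small[OF that] d3(2) by (auto simp: d0_def)
    obtain s t where st: "0 < s" "s < h" "0 < t" "t < h"
      and 1: "F (x + h *\<^sub>R u + h *\<^sub>R v) - F (x + h *\<^sub>R u) - F (x + h *\<^sub>R v) + F x =
        h\<^sup>2 * ?H u v (x + s *\<^sub>R u + t *\<^sub>R v)"
      using second_difference_mean_value[OF h, of S F u x v] F near by blast
    have near': "x + s *\<^sub>R v + t *\<^sub>R u \<in> S" if "0 \<le> s" "s \<le> h" "0 \<le> t" "t \<le> h" for s t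
      using near(1)[of t s] that by (simp add: add_ac)
    obtain s' t' where st': "0 < s'" "s' < h" "0 < t'" "t' < h"
      and 2: "F (x + h *\<^sub>R v + h *\<^sub>R u) - F (x + h *\<^sub>R v) - F (x + h *\<^sub>R u) + F x =
        h\<^sup>2 * ?H v u (x + s' *\<^sub>R v + t' *\<^sub>R u)"
      using second_difference_mean_value[OF h, of S F v x u] F near' by blast
    have comm: "x + a *\<^sub>R v + b *\<^sub>R u = x + b *\<^sub>R u + a *\<^sub>R v" for a b
      by simp
    have "h\<^sup>2 * ?H u v (x + s *\<^sub>R u + t *\<^sub>R v) = h\<^sup>2 * ?H v u (x + t' *\<^sub>R u + s' *\<^sub>R v)"
      using 1 2[unfolded comm] by linarith
    then have eq: "?H u v (x + s *\<^sub>R u + t *\<^sub>R v) = ?H v u (x + t' *\<^sub>R u + s' *\<^sub>R v)"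
      using h by simp
    have "dist (?H u v (x + s *\<^sub>R u + t *\<^sub>R v)) (?H u v x) < e / 2"
      using near st by (intro d(3)) auto
    moreover have "dist (?H v u (x + t' *\<^sub>R u + s' *\<^sub>R v)) (?H v u x) < e / 2"
      using near st' by (intro d(4)) auto
    ultimately show ?thesis unfolding eq dist_real_def by linarith
  qed
  \<comment> \<open>If the difference were nonzero, taking it as its own bound \<open>e\<close>
    would make it smaller than itself.\<close>
  from this[of "\<bar>?H u v x - ?H v u x\<bar>"] show ?thesis by auto
qed

section \<open>Charts and tangent spaces\<close>

lemma comp_simps [simp]:
  "comp 0 c = 0" "comp (u + v) c = comp u c + comp v c" "comp (u - v) c = comp u c - comp v c"
  "comp (- v) c = - comp v c" "comp (a *\<^sub>R v) c = a *\<^sub>R comp v c"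
  by (simp_all add: zero_tvec_def plus_tvec_def minus_tvec_def uminus_tvec_def scaleR_tvec_def)

lemma comp_tvec_at: "comp (tvec_at A p w) c = (if c \<in> A \<and> p \<in> cdom c then w c else 0)"
  by (simp add: tvec_at_def)

lemma tvec_eqI: "(\<And>c. comp u c = comp v c) \<Longrightarrow> u = v"
  by (rule tvec.expand) (rule ext)

locale smooth_atlas =
  fixes M :: "'a topology" and A :: "('a, 'n::finite) chart set"
  assumes smooth_manifold: "smooth_manifold M A"
begin

lemma is_chart: "c \<in> A \<Longrightarrow> is_chart M c"
  using smooth_manifold by (auto simp: smooth_manifold_def)

lemma openin_cdom: "c \<in> A \<Longrightarrow> openin M (cdom c)"
  using is_chart by (auto simp: is_chart_def)

lemma topspace_subtopology_cdom: "c \<in> A \<Longrightarrow> topspace (subtopology M (cdom c)) = cdom c"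
  using openin_subset[OF openin_cdom] by (simp add: Int_absorb1)

lemma inj_on_cmap: "c \<in> A \<Longrightarrow> inj_on (cmap c) (cdom c)"
  using is_chart[of c] homeomorphic_imp_injective_map[of "subtopology M (cdom c)"]
    topspace_subtopology_cdom[of c]
  by (auto simp: is_chart_def)

lemma cinv_cmap: "c \<in> A \<Longrightarrow> p \<in> cdom c \<Longrightarrow> cinv c (cmap c p) = p"
  by (simp add: cinv_def inj_on_cmap)

lemma open_cmap_image:
  assumes "c \<in> A" "openin M W" "W \<subseteq> cdom c"
  shows "open (cmap c ` W)"
proof -
  have "openin (subtopology M (cdom c)) W"
    using assms by (auto simp: openin_subtopology intro!: exI[of _ W])
  then have "openin (top_of_set (cmap c ` cdom c)) (cmap c ` W)"
    using is_chart[OF assms(1)] homeomorphic_imp_open_map[of _ _ "cmap c"]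
    by (auto simp: is_chart_def open_map_def)
  then show ?thesis
    using is_chart[OF assms(1)] by (auto simp: is_chart_def openin_open_eq)
qed

lemma openin_inter_cdom: "c \<in> A \<Longrightarrow> openin M W \<Longrightarrow> openin M (cdom c \<inter> W)"
  by (simp add: openin_Int openin_cdom)

lemma smooth_coordinate_change:
  "c \<in> A \<Longrightarrow> d \<in> A \<Longrightarrow> smooth_on (cmap c ` (cdom c \<inter> cdom d)) (cmap d \<circ> cinv c)"
  using smooth_manifold by (auto simp: smooth_manifold_def)

lemma dtrans_has_derivative:
  assumes "c \<in> A" "d \<in> A" "p \<in> cdom c" "p \<in> cdom d"
  shows "((cmap d \<circ> cinv c) has_derivative dtrans c d p) (at (cmap c p))"
  using smooth_on_imp_differentiable[OF smooth_coordinate_change[OF assms(1,2)]] assms(3,4)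
  by (auto simp: dtrans_def frechet_derivative_works[symmetric])

lemma linear_dtrans:
  "c \<in> A \<Longrightarrow> d \<in> A \<Longrightarrow> p \<in> cdom c \<Longrightarrow> p \<in> cdom d \<Longrightarrow> linear (dtrans c d p)"
  by (rule has_derivative_linear[OF dtrans_has_derivative])

text \<open>Chain rule for coordinate changes. The identity between the maps holds only on the image
  of the triple overlap, whose openness lets the derivative be transferred.\<close>

lemma dtrans_compose:
  assumes "c \<in> A" "d \<in> A" "e \<in> A" "p \<in> cdom c" "p \<in> cdom d" "p \<in> cdom e"
  shows "dtrans d e p (dtrans c d p u) = dtrans c e p u"
proof -
  let ?S = "cmap c ` (cdom c \<inter> (cdom d \<inter> cdom e))"
  have "((cmap e \<circ> cinv d) has_derivative dtrans d e p) (at ((cmap d \<circ> cinv c) (cmap c p)))"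
    using dtrans_has_derivative[of d e p] assms by (simp add: cinv_cmap)
  with dtrans_has_derivative[OF assms(1,2,4,5)]
  have chain: "((cmap e \<circ> cinv d \<circ> (cmap d \<circ> cinv c)) has_derivative
      (dtrans d e p \<circ> dtrans c d p)) (at (cmap c p))"
    by (rule diff_chain_at)
  have S: "open ?S"
    using assms by (intro open_cmap_image openin_inter_cdom openin_cdom) auto
  have "((cmap e \<circ> cinv c) has_derivative (dtrans d e p \<circ> dtrans c d p)) (at (cmap c p))"
    by (rule has_derivative_transform_within_open[OF chain S]) (use assms in \<open>auto simp: cinv_cmap\<close>)
  then have "dtrans d e p \<circ> dtrans c d p = dtrans c e p"
    using dtrans_has_derivative[OF assms(1,3,4,6)] by (rule has_derivative_unique)
  then show ?thesis by (simp add: fun_eq_iff)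
qed

lemma dtrans_self:
  assumes "c \<in> A" "p \<in> cdom c"
  shows "dtrans c c p u = u"
proof -
  have "((cmap c \<circ> cinv c) has_derivative (\<lambda>u. u)) (at (cmap c p))"
    by (rule has_derivative_transform_within_open[OF has_derivative_ident
          open_cmap_image[OF assms(1) openin_cdom[OF assms(1)]]])
      (use assms in \<open>auto simp: cinv_cmap\<close>)
  with dtrans_has_derivative[OF assms(1,1,2,2)] have "dtrans c c p = (\<lambda>u. u)"
    by (rule has_derivative_unique)
  then show ?thesis by simp
qed

lemma tangent_spaceI:
  assumes "\<And>c d. c \<in> A \<Longrightarrow> d \<in> A \<Longrightarrow> p \<in> cdom c \<Longrightarrow> p \<in> cdom d \<Longrightarrow>
      comp v d = dtrans c d p (comp v c)"
    and "\<And>c. c \<notin> A \<or> p \<notin> cdom c \<Longrightarrow> comp v c = 0"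
  shows "v \<in> tangent_space A p"
  using assms unfolding tangent_space_def by blast

lemma tangent_space_comp:
  "v \<in> tangent_space A p \<Longrightarrow> c \<in> A \<Longrightarrow> d \<in> A \<Longrightarrow> p \<in> cdom c \<Longrightarrow> p \<in> cdom d \<Longrightarrow>
    comp v d = dtrans c d p (comp v c)"
  unfolding tangent_space_def by blast

lemma tangent_space_comp_zero:
  "v \<in> tangent_space A p \<Longrightarrow> c \<notin> A \<or> p \<notin> cdom c \<Longrightarrow> comp v c = 0"
  unfolding tangent_space_def by blast

lemma subspace_tangent_space: "subspace (tangent_space A p)"
proof (rule subspaceI)
  show "0 \<in> tangent_space A p"
    using linear_0[OF linear_dtrans] by (intro tangent_spaceI) auto
next
  fix u v assume uv: "u \<in> tangent_space A p" "v \<in> tangent_space A p"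
  show "u + v \<in> tangent_space A p"
  proof (rule tangent_spaceI)
    fix c d assume cd: "c \<in> A" "d \<in> A" "p \<in> cdom c" "p \<in> cdom d"
    show "comp (u + v) d = dtrans c d p (comp (u + v) c)"
      using uv[THEN tangent_space_comp, OF cd] linear_add[OF linear_dtrans[OF cd]] by simp
  qed (simp add: uv[THEN tangent_space_comp_zero])
next
  fix a v assume v: "v \<in> tangent_space A p"
  show "a *\<^sub>R v \<in> tangent_space A p"
  proof (rule tangent_spaceI)
    fix c d assume cd: "c \<in> A" "d \<in> A" "p \<in> cdom c" "p \<in> cdom d"
    show "comp (a *\<^sub>R v) d = dtrans c d p (comp (a *\<^sub>R v) c)"
      using tangent_space_comp[OF v cd] linear_scale[OF linear_dtrans[OF cd]] by simp
  qed (simp add: v[THEN tangent_space_comp_zero])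
qed

lemma tangent_space_zero: "0 \<in> tangent_space A p"
  and tangent_space_diff:
    "u \<in> tangent_space A p \<Longrightarrow> v \<in> tangent_space A p \<Longrightarrow> u - v \<in> tangent_space A p"
  and tangent_space_scaleR: "u \<in> tangent_space A p \<Longrightarrow> a *\<^sub>R u \<in> tangent_space A p"
  using subspace_tangent_space[of p]
  by (auto intro: subspace_0 subspace_diff subspace_scale)

text \<open>The components in one chart around \<open>p\<close> determine those in all others
  through \<open>dtrans\<close>, and components elsewhere are zero by convention. Identities between
  tangent vectors can thus be checked in a single chart.\<close>

lemma tangent_space_eqI:
  assumes "c \<in> A" "p \<in> cdom c" "u \<in> tangent_space A p" "v \<in> tangent_space A p"
    and "comp u c = comp v c"
  shows "u = v"
proof (rule tvec_eqI)
  fix d show "comp u d = comp v d"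
    using assms(3,4)[THEN tangent_space_comp, OF assms(1) _ assms(2)] assms(5)
      assms(3,4)[THEN tangent_space_comp_zero]
    by (cases "d \<in> A \<and> p \<in> cdom d") auto
qed

section \<open>Vector fields with constant components in a chart\<close>

lemma comp_coord_field:
  "d \<in> A \<Longrightarrow> q \<in> cdom c \<Longrightarrow> q \<in> cdom d \<Longrightarrow> comp (coord_field A c u q) d = dtrans c d q u"
  by (simp add: coord_field_def comp_tvec_at)

lemma coord_field_in_tangent_space:
  "c \<in> A \<Longrightarrow> q \<in> cdom c \<Longrightarrow> coord_field A c u q \<in> tangent_space A q"
  by (rule tangent_spaceI) (auto simp: coord_field_def comp_tvec_at dtrans_compose)

lemma coord_field_comp:
  assumes "c \<in> A" "p \<in> cdom c" "v \<in> tangent_space A p"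
  shows "coord_field A c (comp v c) p = v"
  using assms by (intro tangent_space_eqI[OF assms(1,2)])
    (auto simp: coord_field_in_tangent_space comp_coord_field dtrans_self)

text \<open>Stated as an equality of functions so that it rewrites the field argument of a
  connection. Outside \<open>cdom c\<close> both sides are zero.\<close>

lemma coord_field_scaleR:
  assumes "c \<in> A"
  shows "coord_field A c (a *\<^sub>R u) = (\<lambda>q. a *\<^sub>R coord_field A c u q)"
proof (intro ext tvec_eqI)
  fix q d show "comp (coord_field A c (a *\<^sub>R u) q) d = comp (a *\<^sub>R coord_field A c u q) d"
    using assms linear_scale[OF linear_dtrans[of c d q]]
    by (auto simp: coord_field_def comp_tvec_at)
qed

text \<open>Seen from another chart \<open>d\<close>, the components are a derivative of the change
  from \<open>c\<close> to \<open>d\<close>, taken at the \<open>c\<close>-coordinates of the point: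
  a smooth map composed with the smooth change from \<open>d\<close> to \<open>c\<close>.\<close>

lemma smooth_coord_field:
  assumes "c \<in> A"
  shows "smooth_field A (cdom c) (coord_field A c u)"
  unfolding smooth_field_def
proof (intro conjI ballI)
  fix d assume d: "d \<in> A"
  let ?S = "cmap d ` (cdom d \<inter> cdom c)"
  have S: "open ?S"
    using assms d by (intro open_cmap_image openin_inter_cdom openin_cdom) auto
  have "smooth_on ?S (\<lambda>x. frechet_derivative (cmap d \<circ> cinv c) (at ((cmap c \<circ> cinv d) x)) u)"
  proof (rule smooth_on_compose[OF S, where h = "cmap c \<circ> cinv d"
        and f = "\<lambda>y. frechet_derivative (cmap d \<circ> cinv c) (at y) u"])
    show "smooth_on ?S (cmap c \<circ> cinv d)"
      using d assms by (rule smooth_coordinate_change)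
    show "smooth_on (cmap c ` (cdom c \<inter> cdom d))
        (\<lambda>y. frechet_derivative (cmap d \<circ> cinv c) (at y) u)"
      using assms d by (intro smooth_on_frechet_derivative smooth_coordinate_change)
  qed (use d in \<open>auto simp: cinv_cmap\<close>)
  then show "smooth_on ?S (\<lambda>x. comp (coord_field A c u (cinv d x)) d)"
    by (rule smooth_on_cong[OF S]) (use d in \<open>auto simp: cinv_cmap comp_coord_field dtrans_def\<close>)
qed (simp add: assms coord_field_in_tangent_space)

section \<open>Derivatives of functions in an arbitrary chart\<close>

lemma chart_at:
  assumes "p \<in> topspace M"
  shows "chart_at A p \<in> A" "p \<in> cdom (chart_at A p)"
proof -
  have "(\<Union>c\<in>A. cdom c) = topspace M"
    using smooth_manifold by (simp add: smooth_manifold_def)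
  then have "\<exists>c. c \<in> A \<and> p \<in> cdom c"
    using assms by blast
  from someI_ex[OF this] show "chart_at A p \<in> A" "p \<in> cdom (chart_at A p)"
    by (auto simp: chart_at_def)
qed

text \<open>The definition works in a chart picked by a choice operator. The chain rule through the
  coordinate change cancels against the transformation of \<open>v\<close>, so any chart around
  \<open>p\<close> may be used.\<close>

lemma dir_deriv_eq:
  assumes "openin M W" "smooth_fun A W f" "c \<in> A" "p \<in> W" "p \<in> cdom c" "v \<in> tangent_space A p"
  shows "dir_deriv A p v f = frechet_derivative (f \<circ> cinv c) (at (cmap c p)) (comp v c)"
proof -
  define d where "d = chart_at A p"
  have d: "d \<in> A" "p \<in> cdom d"
    using chart_at[of p] assms(1,4) openin_subset[of M W] by (auto simp: d_def)
  let ?S = "cmap c ` (cdom c \<inter> (cdom d \<inter> W))"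
  let ?F' = "frechet_derivative (f \<circ> cinv d) (at (cmap d p))"
  have "(f \<circ> cinv d) differentiable (at (cmap d p))"
    using assms d by (intro smooth_on_imp_differentiable[of "cmap d ` (cdom d \<inter> W)"])
      (auto simp: smooth_fun_def)
  then have "((f \<circ> cinv d) has_derivative ?F') (at ((cmap d \<circ> cinv c) (cmap c p)))"
    using assms by (simp add: frechet_derivative_works[symmetric] cinv_cmap)
  with dtrans_has_derivative[OF assms(3) d(1) assms(5) d(2)]
  have chain: "((f \<circ> cinv d \<circ> (cmap d \<circ> cinv c)) has_derivative (?F' \<circ> dtrans c d p))
      (at (cmap c p))"
    by (rule diff_chain_at)
  have S: "open ?S"
    using assms d by (intro open_cmap_image openin_inter_cdom) auto
  have "((f \<circ> cinv c) has_derivative (?F' \<circ> dtrans c d p)) (at (cmap c p))"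
    by (rule has_derivative_transform_within_open[OF chain S])
      (use assms d in \<open>auto simp: cinv_cmap\<close>)
  from frechet_derivative_at[OF this, symmetric] have
    "frechet_derivative (f \<circ> cinv c) (at (cmap c p)) (comp v c) = ?F' (dtrans c d p (comp v c))"
    by simp
  also have "dtrans c d p (comp v c) = comp v d"
    using tangent_space_comp[OF assms(6,3) d(1) assms(5) d(2)] by simp
  finally show ?thesis unfolding dir_deriv_def Let_def d_def by (rule sym)
qed

lemma dir_deriv_const: "dir_deriv A p v (\<lambda>q. a) = 0"
  by (simp add: dir_deriv_def Let_def o_def)

lemma smooth_fun_const: "smooth_fun A W (\<lambda>q. a)"
  by (simp add: smooth_fun_def o_def smooth_on_const)

end

section \<open>The Levi-Civita connection and its curvature\<close>

locale riemannian_manifold = smooth_atlas M A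
  for M :: "'a topology" and A :: "('a, 'n::finite) chart set" +
  fixes g :: "'a \<Rightarrow> ('a, 'n) tvec \<Rightarrow> ('a, 'n) tvec \<Rightarrow> real" and D :: "('a, 'n) conn"
  assumes riemannian_metric: "riemannian_metric M A g"
    and levi_civita: "levi_civita M A g D"
begin

section \<open>Laws of the metric and of the connection\<close>

lemmas metric_axioms =
  riemannian_metric[unfolded riemannian_metric_def, THEN conjunct1, rule_format]

lemma g_commute:
  "p \<in> topspace M \<Longrightarrow> u \<in> tangent_space A p \<Longrightarrow> v \<in> tangent_space A p \<Longrightarrow> g p u v = g p v u"
  by (rule metric_axioms[THEN conjunct1, rule_format])

lemma g_pos:
  "p \<in> topspace M \<Longrightarrow> u \<in> tangent_space A p \<Longrightarrow> u \<noteq> 0 \<Longrightarrow> g p u u > 0"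
  by (rule metric_axioms[THEN conjunct2, THEN conjunct1, rule_format])

lemma g_lincomb:
  "p \<in> topspace M \<Longrightarrow> u \<in> tangent_space A p \<Longrightarrow> v \<in> tangent_space A p \<Longrightarrow>
    w \<in> tangent_space A p \<Longrightarrow> g p (a *\<^sub>R u + b *\<^sub>R v) w = a * g p u w + b * g p v w"
  by (rule metric_axioms[THEN conjunct2, THEN conjunct2, rule_format])

lemma g_scaleR_left:
  "p \<in> topspace M \<Longrightarrow> u \<in> tangent_space A p \<Longrightarrow> w \<in> tangent_space A p \<Longrightarrow>
    g p (a *\<^sub>R u) w = a * g p u w"
  using g_lincomb[of p u u w a 0] by simp

lemma g_diff_left:
  "p \<in> topspace M \<Longrightarrow> u \<in> tangent_space A p \<Longrightarrow> v \<in> tangent_space A p \<Longrightarrow>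
    w \<in> tangent_space A p \<Longrightarrow> g p (u - v) w = g p u w - g p v w"
  using g_lincomb[of p u v w 1 "-1"] by simp

lemma g_zero_left: "p \<in> topspace M \<Longrightarrow> w \<in> tangent_space A p \<Longrightarrow> g p 0 w = 0"
  using g_scaleR_left[of p 0 w 0] by (simp add: tangent_space_zero)

lemma smooth_fun_g:
  "openin M W \<Longrightarrow> smooth_field A W X \<Longrightarrow> smooth_field A W Y \<Longrightarrow>
    smooth_fun A W (\<lambda>p. g p (X p) (Y p))"
  by (rule riemannian_metric[unfolded riemannian_metric_def, THEN conjunct2, rule_format])

lemma smooth_fieldD: "smooth_field A W X \<Longrightarrow> p \<in> W \<Longrightarrow> X p \<in> tangent_space A p"
  unfolding smooth_field_def by blast

lemma affine_connection: "affine_connection M A D"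
  using levi_civita unfolding levi_civita_def by blast

context
  fixes W :: "'a set" and Y :: "'a \<Rightarrow> ('a, 'n) tvec"
  assumes W: "openin M W" and Y: "smooth_field A W Y"
begin

lemmas connection_axioms = affine_connection[unfolded affine_connection_def, rule_format, OF W Y]

lemma D_in_tangent_space: "p \<in> W \<Longrightarrow> v \<in> tangent_space A p \<Longrightarrow> D p v Y \<in> tangent_space A p"
  by (rule connection_axioms[THEN conjunct1, rule_format, THEN conjunct1])

lemma D_lincomb_direction:
  "p \<in> W \<Longrightarrow> u \<in> tangent_space A p \<Longrightarrow> v \<in> tangent_space A p \<Longrightarrow>
    D p (a *\<^sub>R u + b *\<^sub>R v) Y = a *\<^sub>R D p u Y + b *\<^sub>R D p v Y"
  by (rule connection_axioms[THEN conjunct1, rule_format, THEN conjunct2, rule_format])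

lemma D_scaleR_direction:
  "p \<in> W \<Longrightarrow> v \<in> tangent_space A p \<Longrightarrow> D p (a *\<^sub>R v) Y = a *\<^sub>R D p v Y"
  using D_lincomb_direction[of p v v a 0] by simp

lemma D_zero_direction: "p \<in> W \<Longrightarrow> D p 0 Y = 0"
  using D_scaleR_direction[of p 0 0] by (simp add: tangent_space_zero)

lemma D_leibniz:
  "smooth_fun A W f \<Longrightarrow> p \<in> W \<Longrightarrow> v \<in> tangent_space A p \<Longrightarrow>
    D p v (\<lambda>q. f q *\<^sub>R Y q) = f p *\<^sub>R D p v Y + dir_deriv A p v f *\<^sub>R Y p"
  by (rule connection_axioms[THEN conjunct2, THEN conjunct2, THEN conjunct1, rule_format])

lemma D_scaleR:
  "p \<in> W \<Longrightarrow> v \<in> tangent_space A p \<Longrightarrow> D p v (\<lambda>q. a *\<^sub>R Y q) = a *\<^sub>R D p v Y"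
  using D_leibniz[OF smooth_fun_const] by (simp add: dir_deriv_const)

lemma D_cong:
  "(\<And>q. q \<in> W \<Longrightarrow> Z q = Y q) \<Longrightarrow> p \<in> W \<Longrightarrow> v \<in> tangent_space A p \<Longrightarrow> D p v Z = D p v Y"
  by (rule connection_axioms[THEN conjunct2, THEN conjunct2, THEN conjunct2, THEN conjunct1, rule_format])

lemma smooth_field_D: "smooth_field A W X \<Longrightarrow> smooth_field A W (\<lambda>p. D p (X p) Y)"
  by (rule connection_axioms[THEN conjunct2, THEN conjunct2, THEN conjunct2, THEN conjunct2, rule_format])

lemma D_torsion_free:
  "smooth_field A W X \<Longrightarrow> p \<in> W \<Longrightarrow> D p (X p) Y - D p (Y p) X = lie_bracket A X Y p"
  by (rule levi_civita[unfolded levi_civita_def, THEN conjunct2, rule_format, OF W _ Y,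
        THEN conjunct1, rule_format])

lemma D_metric:
  "smooth_field A W X \<Longrightarrow> p \<in> W \<Longrightarrow> v \<in> tangent_space A p \<Longrightarrow>
    dir_deriv A p v (\<lambda>q. g q (X q) (Y q)) = g p (D p v X) (Y p) + g p (X p) (D p v Y)"
  by (rule levi_civita[unfolded levi_civita_def, THEN conjunct2, rule_format, OF W _ Y,
        THEN conjunct2, rule_format])

end

section \<open>Curvature computed with coordinate fields\<close>

lemma lie_bracket_coord_field:
  assumes c: "c \<in> A" and p: "p \<in> cdom c"
  shows "lie_bracket A (coord_field A c u) (coord_field A c v) p = 0" (is "?B = 0")
proof (rule tangent_space_eqI[OF c p])
  note X = smooth_coord_field[OF c]
  \<comment> \<open>Torsion-freeness shows that the bracket is a tangent vector. Afterwards its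
    components in the chart \<open>c\<close> suffice, and there both fields are constant.\<close>
  have "?B = D p (coord_field A c u p) (coord_field A c v) - D p (coord_field A c v p) (coord_field A c u)"
    using D_torsion_free[OF openin_cdom[OF c] X X p] by simp
  then show "?B \<in> tangent_space A p"
    using D_in_tangent_space[OF openin_cdom[OF c] X p] coord_field_in_tangent_space[OF c p]
    by (simp add: tangent_space_diff)
  have const: "frechet_derivative (\<lambda>x. comp (coord_field A c w (cinv c x)) c) (at (cmap c p)) = (\<lambda>_. 0)"
    for w
  proof -
    have "((\<lambda>x. comp (coord_field A c w (cinv c x)) c) has_derivative (\<lambda>_. 0)) (at (cmap c p))"
      by (rule has_derivative_transform_within_open[OF has_derivative_const
            open_cmap_image[OF c openin_cdom[OF c]]])
        (use c p in \<open>auto simp: cinv_cmap comp_coord_field dtrans_self\<close>)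
    from frechet_derivative_at[OF this] show ?thesis by simp
  qed
  show "comp ?B c = comp 0 c"
    by (simp add: lie_bracket_def comp_tvec_at const)
qed (rule tangent_space_zero)

lemma curv_field_coord_field:
  assumes c: "c \<in> A" and p: "p \<in> cdom c"
  shows "curv_field A D (coord_field A c u) (coord_field A c v) (coord_field A c w) p =
    D p (coord_field A c u p) (\<lambda>q. D q (coord_field A c v q) (coord_field A c w)) -
    D p (coord_field A c v p) (\<lambda>q. D q (coord_field A c u q) (coord_field A c w))"
  using D_zero_direction[OF openin_cdom smooth_coord_field] assms
  by (simp add: curv_field_def lie_bracket_coord_field)

lemma curv_eq:
  "curv A D p x y z = curv_field A D
    (coord_field A (chart_at A p) (comp x (chart_at A p)))
    (coord_field A (chart_at A p) (comp y (chart_at A p)))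
    (coord_field A (chart_at A p) (comp z (chart_at A p))) p"
  by (simp add: curv_def Let_def)

lemma curv_in_tangent_space: "p \<in> topspace M \<Longrightarrow> curv A D p x y z \<in> tangent_space A p"
  unfolding curv_eq
  by (simp add: curv_field_coord_field chart_at tangent_space_diff
      D_in_tangent_space[OF openin_cdom smooth_field_D[OF openin_cdom smooth_coord_field smooth_coord_field]]
      coord_field_in_tangent_space)

lemma curv_antisym: "p \<in> topspace M \<Longrightarrow> curv A D p y x z = - curv A D p x y z"
  unfolding curv_eq by (simp add: curv_field_coord_field chart_at)

text \<open>Scaling a vector scales its extension by a constant, so no derivative of the scalar
  arises and the factors pass through both covariant derivatives.\<close>

lemma curv_scaleR:
  assumes p: "p \<in> topspace M"
  shows "curv A D p (a *\<^sub>R x) (b *\<^sub>R y) z = (a * b) *\<^sub>R curv A D p x y z"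
proof -
  define c where "c = chart_at A p"
  have c: "c \<in> A" "p \<in> cdom c" using chart_at[OF p] by (auto simp: c_def)
  define ext where "ext v = coord_field A c (comp v c)" for v
  note smooth = smooth_coord_field[OF c(1)] and W = openin_cdom[OF c(1)]
  note tan = coord_field_in_tangent_space[OF c(1)]
  have "D p (a *\<^sub>R ext x p) (\<lambda>q. D q (b *\<^sub>R ext y q) (ext z)) =
      (a * b) *\<^sub>R D p (ext x p) (\<lambda>q. D q (ext y q) (ext z))" for a b x y
  proof -
    have t: "a *\<^sub>R ext x p \<in> tangent_space A p"
      unfolding ext_def by (intro tangent_space_scaleR tan c)
    have s: "smooth_field A (cdom c) (\<lambda>q. D q (ext y q) (ext z))"
      unfolding ext_def by (intro smooth_field_D W smooth)
    \<comment> \<open>\<open>D_cong\<close> asks for smoothness of exactly this field. Moving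
      \<open>b\<close> into the components turns the scaled direction back into a coordinate
      field.\<close>
    have sb: "smooth_field A (cdom c) (\<lambda>q. D q (b *\<^sub>R ext y q) (ext z))"
      unfolding ext_def coord_field_scaleR[OF c(1), symmetric] fun_cong[OF coord_field_scaleR[OF c(1)], symmetric]
      by (intro smooth_field_D W smooth)
    have "D p (a *\<^sub>R ext x p) (\<lambda>q. D q (b *\<^sub>R ext y q) (ext z)) =
        D p (a *\<^sub>R ext x p) (\<lambda>q. b *\<^sub>R D q (ext y q) (ext z))"
      by (rule D_cong[OF W sb _ c(2) t, symmetric])
        (simp add: ext_def D_scaleR_direction[OF W smooth] tan)
    also have "\<dots> = b *\<^sub>R D p (a *\<^sub>R ext x p) (\<lambda>q. D q (ext y q) (ext z))"
      by (rule D_scaleR[OF W s c(2) t])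
    also have "D p (a *\<^sub>R ext x p) (\<lambda>q. D q (ext y q) (ext z)) =
        a *\<^sub>R D p (ext x p) (\<lambda>q. D q (ext y q) (ext z))"
      by (rule D_scaleR_direction[OF W s c(2)]) (simp add: ext_def tan c)
    finally show ?thesis by (simp add: mult.commute)
  qed
  \<comment> \<open>The second use, with the two pairs exchanged, treats the subtracted term of the
    curvature.\<close>
  from this[of a x b y] this[of b y a x] show ?thesis
    unfolding curv_eq c_def[symmetric] curv_field_coord_field[OF c]
    by (simp add: coord_field_scaleR[OF c(1)] ext_def scaleR_diff_right mult.commute)
qed

text \<open>For coordinate fields \<open>X, Y\<close> the second derivatives \<open>XY\<langle>Z,Z\<rangle>\<close> and \<open>YX\<langle>Z,Z\<rangle>\<close> agree; by metric
  compatibility their difference is \<open>2\<langle>R(X,Y)Z,Z\<rangle>\<close>.\<close>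

lemma g_curv_self:
  assumes p: "p \<in> topspace M" and x: "x \<in> tangent_space A p" and y: "y \<in> tangent_space A p"
    and z: "z \<in> tangent_space A p"
  shows "g p (curv A D p x y z) z = 0"
proof -
  define c where "c = chart_at A p"
  have c: "c \<in> A" "p \<in> cdom c" using chart_at[OF p] by (auto simp: c_def)
  define ext where "ext v = coord_field A c (comp v c)" for v
  let ?Z = "ext z" and ?S = "cmap c ` cdom c" and ?x0 = "cmap c p"
  define f where "f = (\<lambda>q. g q (?Z q) (?Z q))"
  have W: "openin M (cdom c)" by (rule openin_cdom[OF c(1)])
  have S: "open ?S" by (rule open_cmap_image[OF c(1) W order_refl])
  have smooth: "smooth_field A (cdom c) (ext v)" for v
    unfolding ext_def by (rule smooth_coord_field[OF c(1)])
  have DZ: "smooth_field A (cdom c) (\<lambda>q. D q (ext v q) ?Z)" for v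
    by (intro smooth_field_D W smooth)
  have tan: "ext v q \<in> tangent_space A q" if "q \<in> cdom c" for v q
    using smooth_fieldD[OF smooth that] .
  have top: "q \<in> topspace M" if "q \<in> cdom c" for q
    using openin_subset[OF W] that by blast
  have ext_p: "ext v p = v" if "v \<in> tangent_space A p" for v
    using that c by (simp add: ext_def coord_field_comp)
  have comp_ext: "comp (ext v q) c = comp v c" if "q \<in> cdom c" for v q
    using that c by (simp add: ext_def comp_coord_field dtrans_self)
  have f: "smooth_fun A (cdom c) f"
    unfolding f_def by (intro smooth_fun_g W smooth)
  have h: "smooth_fun A (cdom c) (\<lambda>q. g q (D q (ext v q) ?Z) (?Z q))" for v
    by (intro smooth_fun_g W smooth DZ)
  \<comment> \<open>Metric compatibility with equal entries gives two equal terms, hence the factor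
    2. On the right the direction \<open>comp v c\<close> is the same at all points of the chart, so
    the identity can be differentiated again.\<close>
  have first: "2 * g q (D q (ext v q) ?Z) (?Z q) =
      frechet_derivative (f \<circ> cinv c) (at (cmap c q)) (comp v c)" if q: "q \<in> cdom c" for v q
  proof -
    have "D q (ext v q) ?Z \<in> tangent_space A q" by (rule smooth_fieldD[OF DZ q])
    then have "2 * g q (D q (ext v q) ?Z) (?Z q) = dir_deriv A q (ext v q) f"
      unfolding f_def using D_metric[OF W smooth smooth q tan[OF q]] g_commute[OF top[OF q]] tan[OF q]
      by simp
    also have "\<dots> = frechet_derivative (f \<circ> cinv c) (at (cmap c q)) (comp v c)"
      using dir_deriv_eq[OF W f c(1) q q tan[OF q]] by (simp add: comp_ext[OF q])
    finally show ?thesis .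
  qed
  \<comment> \<open>Differentiating \<open>first\<close> along \<open>u\<close> produces the second
    covariant derivative and a product of first ones. That product is symmetric in \<open>u\<close>
    and \<open>v\<close> and drops out when the two orders are compared.\<close>
  have second: "2 * g p (D p u (\<lambda>q. D q (ext v q) ?Z)) z + 2 * g p (D p v ?Z) (D p u ?Z) =
      frechet_derivative (\<lambda>\<xi>. frechet_derivative (f \<circ> cinv c) (at \<xi>) (comp v c)) (at ?x0) (comp u c)"
    if u: "u \<in> tangent_space A p" and v: "v \<in> tangent_space A p" for u v
  proof -
    let ?h = "\<lambda>q. g q (D q (ext v q) ?Z) (?Z q)"
    have "(?h \<circ> cinv c) differentiable (at ?x0)"
      using h[of v] c by (intro smooth_on_imp_differentiable[of ?S]) (auto simp: smooth_fun_def)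
    then have "((\<lambda>\<xi>. 2 * (?h \<circ> cinv c) \<xi>) has_derivative
        (\<lambda>w. 2 * frechet_derivative (?h \<circ> cinv c) (at ?x0) w)) (at ?x0)"
      unfolding frechet_derivative_works by (rule has_derivative_mult_right)
    then have "((\<lambda>\<xi>. frechet_derivative (f \<circ> cinv c) (at \<xi>) (comp v c)) has_derivative
        (\<lambda>w. 2 * frechet_derivative (?h \<circ> cinv c) (at ?x0) w)) (at ?x0)"
      by (rule has_derivative_transform_within_open[OF _ S])
        (use c first in \<open>auto simp: cinv_cmap\<close>)
    from frechet_derivative_at[OF this, symmetric]
    have "frechet_derivative (\<lambda>\<xi>. frechet_derivative (f \<circ> cinv c) (at \<xi>) (comp v c)) (at ?x0) (comp u c) =
        2 * dir_deriv A p u ?h"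
      using dir_deriv_eq[OF W h c(1) c(2) c(2) u] by simp
    also have "dir_deriv A p u ?h = g p (D p u (\<lambda>q. D q (ext v q) ?Z)) z + g p (D p v ?Z) (D p u ?Z)"
      using D_metric[OF W smooth DZ c(2) u] by (simp add: ext_p z v)
    finally show ?thesis unfolding distrib_left by (rule sym)
  qed
  have "smooth_on ?S (f \<circ> cinv c)"
    using f c(1) by (auto simp: smooth_fun_def)
  then have "frechet_derivative (\<lambda>\<xi>. frechet_derivative (f \<circ> cinv c) (at \<xi>) (comp y c)) (at ?x0) (comp x c) =
      frechet_derivative (\<lambda>\<xi>. frechet_derivative (f \<circ> cinv c) (at \<xi>) (comp x c)) (at ?x0) (comp y c)"
    using c by (intro second_derivative_symmetric[OF S]) (auto simp: smooth_on_def)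
  moreover have tan': "D p v ?Z \<in> tangent_space A p" if "v \<in> tangent_space A p" for v
    by (rule D_in_tangent_space[OF W smooth c(2) that])
  ultimately have eq: "g p (D p x (\<lambda>q. D q (ext y q) ?Z)) z = g p (D p y (\<lambda>q. D q (ext x q) ?Z)) z"
    using second[OF x y] second[OF y x] g_commute[OF p tan'[OF x] tan'[OF y]] by simp
  have "curv A D p x y z = D p x (\<lambda>q. D q (ext y q) ?Z) - D p y (\<lambda>q. D q (ext x q) ?Z)"
    unfolding curv_eq c_def[symmetric] curv_field_coord_field[OF c]
    unfolding ext_def[symmetric] by (simp add: ext_p x y)
  then show ?thesis
    using eq g_diff_left[OF p] D_in_tangent_space[OF W DZ c(2)] x y z by simp
qed

end

text \<open>Let W be the part of R = R(N,T)T left after subtracting its projection to N. It is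
  orthogonal to N by construction and to T by \<open>g_curv_self\<close>, so the hypothesis gives
  \<langle>R,W\<rangle> = 0. Since \<langle>W,W\<rangle> = \<langle>R,W\<rangle>, positive
  definiteness yields W = 0.\<close>

lemma (in riemannian_manifold) curv_eq_scaleR_normal:
  assumes p: "p \<in> topspace M" and T: "T \<in> tangent_space A p" and N: "N \<in> tangent_space A p"
    and TT: "g p T T = 1" and NN: "g p N N = 1" and TN: "g p T N = 0"
    and orth: "\<And>W. W \<in> tangent_space A p \<Longrightarrow> (\<And>U. U \<in> span {T, N} \<Longrightarrow> g p U W = 0) \<Longrightarrow>
      g p (curv A D p T N T) W = 0"
  shows "curv A D p N T T = curv4 A g D p N T N T *\<^sub>R N"
proof -
  define R where "R = curv A D p N T T"
  define W where "W = R - g p R N *\<^sub>R N"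
  have R: "R \<in> tangent_space A p" unfolding R_def by (rule curv_in_tangent_space[OF p])
  have RT: "g p R T = 0" unfolding R_def by (rule g_curv_self[OF p N T T])
  have W: "W \<in> tangent_space A p"
    unfolding W_def by (intro tangent_space_diff tangent_space_scaleR R N)
  have W_left: "g p W U = g p R U - g p R N * g p N U" if "U \<in> tangent_space A p" for U
    unfolding W_def g_diff_left[OF p R tangent_space_scaleR[OF N] that] g_scaleR_left[OF p N that] ..
  have NT: "g p N T = 0" using TN g_commute[OF p T N] by simp
  have TW: "g p T W = 0"
    unfolding g_commute[OF p T W] W_left[OF T] by (simp add: RT NT)
  have NW: "g p N W = 0"
    unfolding g_commute[OF p N W] W_left[OF N] by (simp add: NN)
  have "g p U W = 0" if U: "U \<in> span {T, N}" for U
  proof -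
    obtain a where "U - a *\<^sub>R T \<in> span {N}"
      using U unfolding span_breakdown_eq[of U T] by blast
    then obtain b where "U - a *\<^sub>R T = b *\<^sub>R N"
      by (auto simp: span_singleton)
    then have "U = a *\<^sub>R T + b *\<^sub>R N" by (simp add: algebra_simps)
    then show ?thesis
      by (simp add: g_lincomb[OF p T N W] TW NW)
  qed
  from orth[OF W this] have "g p (curv A D p T N T) W = 0" .
  moreover have "curv A D p T N T = (- 1) *\<^sub>R R"
    unfolding R_def using curv_antisym[OF p, of T N] by simp
  ultimately have "g p R W = 0"
    using g_scaleR_left[OF p R W, of "-1"] by simp
  then have "g p W W = 0"
    by (simp add: W_left[OF W] NW)
  then have "W = 0"
    using g_pos[OF p W] by (cases "W = 0") auto
  then show ?thesis
    by (simp add: W_def R_def curv4_def)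
qed

section \<open>Covariant derivatives along curves\<close>

text \<open>A connected set with more than one point has no isolated points. This makes derivatives
  within the interval unique, also at its end points.\<close>

lemma at_within_interval_neq_bot:
  fixes I :: "real set"
  assumes "is_interval I" "interior I \<noteq> {}" "t \<in> I"
  shows "at t within I \<noteq> bot"
proof -
  have "\<nexists>x. I = {x}"
    using assms(2) by auto
  then have "t islimpt I"
    using assms by (intro connected_imp_perfect is_interval_connected) auto
  then show ?thesis
    by (simp add: trivial_limit_within)
qed

locale smooth_curve_on_manifold = riemannian_manifold M A g D
  for M :: "'a topology" and A :: "('a, 'n::finite) chart set" and g D +
  fixes I :: "real set" and \<gamma> :: "real \<Rightarrow> 'a"
  assumes smooth_curve: "smooth_curve M A I \<gamma>"
begin

lemma curve_in_topspace: "t \<in> I \<Longrightarrow> \<gamma> t \<in> topspace M"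
  using smooth_curve by (auto simp: smooth_curve_def continuous_map_def)

lemma at_within_neq_bot: "t \<in> I \<Longrightarrow> at t within I \<noteq> bot"
  using smooth_curve at_within_interval_neq_bot by (auto simp: smooth_curve_def)

lemma curve_locally_in_open:
  assumes "openin M W" "t \<in> I" "\<gamma> t \<in> W"
  obtains d where "d > 0" "\<And>s. s \<in> I \<Longrightarrow> dist s t < d \<Longrightarrow> \<gamma> s \<in> W"
proof -
  have "openin (top_of_set I) {s \<in> I. \<gamma> s \<in> W}"
    using smooth_curve openin_continuous_map_preimage[of "top_of_set I" M \<gamma> W] assms(1)
    by (simp add: smooth_curve_def)
  then obtain d where "d > 0" "\<forall>s\<in>I. dist s t < d \<longrightarrow> s \<in> {s \<in> I. \<gamma> s \<in> W}"
    using assms(2,3) unfolding openin_euclidean_subtopology_iff by blast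
  then show ?thesis by (intro that) auto
qed

lemma nth_deriv_curve_differentiable:
  "c \<in> A \<Longrightarrow> t \<in> I \<Longrightarrow> \<gamma> t \<in> cdom c \<Longrightarrow>
    nth_deriv_within I k (\<lambda>s. cmap c (\<gamma> s)) differentiable (at t within I)"
  using smooth_curve by (simp add: smooth_curve_def)

lemma curve_has_vector_derivative:
  assumes "c \<in> A" "t \<in> I" "\<gamma> t \<in> cdom c"
  shows "((\<lambda>s. cmap c (\<gamma> s)) has_vector_derivative comp (velocity A I \<gamma> t) c) (at t within I)"
  using nth_deriv_curve_differentiable[OF assms, of 0] assms
  by (simp add: vector_derivative_works velocity_def comp_tvec_at)

text \<open>The chain rule gives a second derivative within \<open>I\<close> of the curve in the
  chart \<open>d\<close>; uniqueness of such derivatives yields the transformation law.\<close>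

lemma velocity_in_tangent_space:
  assumes t: "t \<in> I"
  shows "velocity A I \<gamma> t \<in> tangent_space A (\<gamma> t)"
proof (rule tangent_spaceI)
  fix c d assume cd: "c \<in> A" "d \<in> A" "\<gamma> t \<in> cdom c" "\<gamma> t \<in> cdom d"
  let ?v = "\<lambda>c. comp (velocity A I \<gamma> t) c"
  obtain e where e: "e > 0" "\<And>s. s \<in> I \<Longrightarrow> dist s t < e \<Longrightarrow> \<gamma> s \<in> cdom c"
    using curve_locally_in_open[OF openin_cdom[OF cd(1)] t cd(3)] by blast
  have "((\<lambda>s. cmap c (\<gamma> s)) has_derivative (\<lambda>h. h *\<^sub>R ?v c)) (at t within I)"
    using curve_has_vector_derivative[OF cd(1) t cd(3)] by (simp add: has_vector_derivative_def)
  from diff_chain_within[OF this has_derivative_at_withinI[OF dtrans_has_derivative[OF cd]]]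
  have "((\<lambda>s. (cmap d \<circ> cinv c) (cmap c (\<gamma> s))) has_derivative
      (\<lambda>h. h *\<^sub>R dtrans c d (\<gamma> t) (?v c))) (at t within I)"
    by (simp add: o_def linear_scale[OF linear_dtrans[OF cd]])
  then have "((\<lambda>s. cmap d (\<gamma> s)) has_vector_derivative dtrans c d (\<gamma> t) (?v c)) (at t within I)"
    unfolding has_vector_derivative_def
    by (rule has_derivative_transform_within[OF _ e(1) t]) (simp add: e(2) cinv_cmap cd(1))
  with curve_has_vector_derivative[OF cd(2) t cd(4)]
  show "?v d = dtrans c d (\<gamma> t) (?v c)"
    using vector_derivative_unique_within[OF at_within_neq_bot[OF t]] by blast
qed (auto simp: velocity_def comp_tvec_at)

text \<open>The components in \<open>c\<close> are the derivative of the coordinate curve only while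
  the curve stays in \<open>cdom c\<close>, and zero otherwise. The two functions therefore have to
  be compared near \<open>t\<close>.\<close>

lemma velocity_differentiable:
  assumes "c \<in> A" "t \<in> I" "\<gamma> t \<in> cdom c"
  shows "(\<lambda>s. comp (velocity A I \<gamma> s) c) differentiable (at t within I)"
proof -
  obtain e where e: "e > 0" "\<And>s. s \<in> I \<Longrightarrow> dist s t < e \<Longrightarrow> \<gamma> s \<in> cdom c"
    using curve_locally_in_open[OF openin_cdom[OF assms(1)] assms(2,3)] by blast
  show ?thesis
    using nth_deriv_curve_differentiable[OF assms, of 1]
    by (rule differentiable_transform_within[OF _ e(1) assms(2)])
      (simp add: velocity_def comp_tvec_at e(2) assms(1))
qed

text \<open>Derivatives within \<open>I\<close> see only values on \<open>I\<close>. The Frenet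
  equations hold only there, so they are substituted into further derivatives by this rule.\<close>

lemma cov_deriv_cong:
  assumes "t \<in> I" "\<And>s. s \<in> I \<Longrightarrow> V s = V' s"
  shows "cov_deriv A D I \<gamma> V t = cov_deriv A D I \<gamma> V' t"
proof -
  have "vector_derivative (\<lambda>s. comp (V s) c) (at t within I) =
      vector_derivative (\<lambda>s. comp (V' s) c) (at t within I)" for c
    using assms by (intro vector_derivative_cong_eq) auto
  then show ?thesis
    using assms by (simp add: cov_deriv_def)
qed

lemma cov_deriv_scaleR:
  assumes t: "t \<in> I"
    and V: "\<And>c. c \<in> A \<Longrightarrow> \<gamma> t \<in> cdom c \<Longrightarrow> (\<lambda>s. comp (V s) c) differentiable (at t within I)"
  shows "cov_deriv A D I \<gamma> (\<lambda>s. a *\<^sub>R V s) t = a *\<^sub>R cov_deriv A D I \<gamma> V t"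
proof (rule tvec_eqI)
  fix c
  show "comp (cov_deriv A D I \<gamma> (\<lambda>s. a *\<^sub>R V s) t) c = comp (a *\<^sub>R cov_deriv A D I \<gamma> V t) c"
  proof (cases "c \<in> A \<and> \<gamma> t \<in> cdom c")
    case True
    then have c: "c \<in> A" "\<gamma> t \<in> cdom c" by auto
    have "((\<lambda>s. a *\<^sub>R comp (V s) c) has_vector_derivative
        a *\<^sub>R vector_derivative (\<lambda>s. comp (V s) c) (at t within I)) (at t within I)"
      using V[OF c] by (auto simp: vector_derivative_works intro!: derivative_eq_intros)
    then have "vector_derivative (\<lambda>s. a *\<^sub>R comp (V s) c) (at t within I) =
        a *\<^sub>R vector_derivative (\<lambda>s. comp (V s) c) (at t within I)"
      by (rule vector_derivative_within[OF at_within_neq_bot[OF t]])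
    moreover have "D (\<gamma> t) (velocity A I \<gamma> t) (coord_field A c (a *\<^sub>R comp (V t) c)) =
        a *\<^sub>R D (\<gamma> t) (velocity A I \<gamma> t) (coord_field A c (comp (V t) c))"
      unfolding coord_field_scaleR[OF c(1)]
      by (rule D_scaleR[OF openin_cdom[OF c(1)] smooth_coord_field[OF c(1)] c(2)
            velocity_in_tangent_space[OF t]])
    ultimately show ?thesis
      by (simp add: cov_deriv_def comp_tvec_at scaleR_add_right)
  qed (auto simp: cov_deriv_def comp_tvec_at)
qed

end

section \<open>Iterated derivatives and tension of a helix\<close>

locale frenet_curve = smooth_curve_on_manifold M A g D I \<gamma>
  for M :: "'a topology" and A :: "('a, 'n::finite) chart set" and g D I \<gamma> +
  fixes T N :: "real \<Rightarrow> ('a, 'n) tvec" and \<kappa> :: real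
  assumes T: "T = velocity A I \<gamma>"
    and N_differentiable: "\<And>c t. c \<in> A \<Longrightarrow> t \<in> I \<Longrightarrow> \<gamma> t \<in> cdom c \<Longrightarrow>
      (\<lambda>s. comp (N s) c) differentiable (at t within I)"
    and cov_deriv_T: "\<And>t. t \<in> I \<Longrightarrow> cov_deriv A D I \<gamma> T t = \<kappa> *\<^sub>R N t"
    and cov_deriv_N: "\<And>t. t \<in> I \<Longrightarrow> cov_deriv A D I \<gamma> N t = - \<kappa> *\<^sub>R T t"
begin

lemma cov_deriv_pow_T_even:
    "t \<in> I \<Longrightarrow> cov_deriv_pow_T A D I \<gamma> (2 * k) t = ((-1) ^ k * \<kappa> ^ (2 * k)) *\<^sub>R T t"
  and cov_deriv_pow_T_odd:
    "t \<in> I \<Longrightarrow> cov_deriv_pow_T A D I \<gamma> (2 * k + 1) t = ((-1) ^ k * \<kappa> ^ (2 * k + 1)) *\<^sub>R N t"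
proof -
  have "\<forall>t\<in>I. cov_deriv_pow_T A D I \<gamma> (2 * k) t = ((-1) ^ k * \<kappa> ^ (2 * k)) *\<^sub>R T t \<and>
    cov_deriv_pow_T A D I \<gamma> (2 * k + 1) t = ((-1) ^ k * \<kappa> ^ (2 * k + 1)) *\<^sub>R N t"
  proof (induction k)
    case 0
    show ?case by (simp add: cov_deriv_T flip: T)
  next
    case (Suc k)
    let ?P = "cov_deriv_pow_T A D I \<gamma>"
    have even: "?P (2 * Suc k) t = ((-1) ^ Suc k * \<kappa> ^ (2 * Suc k)) *\<^sub>R T t" if t: "t \<in> I" for t
    proof -
      have "?P (2 * Suc k) t = cov_deriv A D I \<gamma> (?P (2 * k + 1)) t" by simp
      also have "\<dots> = cov_deriv A D I \<gamma> (\<lambda>s. ((-1) ^ k * \<kappa> ^ (2 * k + 1)) *\<^sub>R N s) t"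
        using Suc.IH t by (intro cov_deriv_cong) auto
      also have "\<dots> = ((-1) ^ k * \<kappa> ^ (2 * k + 1)) *\<^sub>R cov_deriv A D I \<gamma> N t"
        using t N_differentiable by (intro cov_deriv_scaleR) auto
      finally show ?thesis using cov_deriv_N[OF t] by simp
    qed
    moreover have "?P (2 * Suc k + 1) t = ((-1) ^ Suc k * \<kappa> ^ (2 * Suc k + 1)) *\<^sub>R N t"
      if t: "t \<in> I" for t
    proof -
      have "?P (2 * Suc k + 1) t = cov_deriv A D I \<gamma> (?P (2 * Suc k)) t" by simp
      also have "\<dots> = cov_deriv A D I \<gamma> (\<lambda>s. ((-1) ^ Suc k * \<kappa> ^ (2 * Suc k)) *\<^sub>R T s) t"
        using even t by (intro cov_deriv_cong)
      also have "\<dots> = ((-1) ^ Suc k * \<kappa> ^ (2 * Suc k)) *\<^sub>R cov_deriv A D I \<gamma> T t"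
        using t velocity_differentiable unfolding T by (intro cov_deriv_scaleR) auto
      finally show ?thesis using cov_deriv_T[OF t] by simp
    qed
    ultimately show ?case by blast
  qed
  then show "t \<in> I \<Longrightarrow> cov_deriv_pow_T A D I \<gamma> (2 * k) t = ((-1) ^ k * \<kappa> ^ (2 * k)) *\<^sub>R T t"
    and "t \<in> I \<Longrightarrow>
      cov_deriv_pow_T A D I \<gamma> (2 * k + 1) t = ((-1) ^ k * \<kappa> ^ (2 * k + 1)) *\<^sub>R N t"
    by blast+
qed

text \<open>For an even index the curvature arguments are multiples of N and T in this order, for an
  odd index of T and N. Either way the powers of \<kappa> add up to 2r-3, and the sign is the same
  after antisymmetry has absorbed that of the odd case.\<close>

lemma tension_eq:
  assumes t: "t \<in> I" and r: "r \<ge> 2"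
  shows "tension A D I r \<gamma> t = ((-1) ^ (r - 1) * \<kappa> ^ (2 * r - 3)) *\<^sub>R
    (\<kappa>\<^sup>2 *\<^sub>R N t - (real r - 1) *\<^sub>R curv A D (\<gamma> t) (N t) (T t) (T t))"
proof -
  \<comment> \<open>Writing r = m + 2 turns the truncated differences 2r-1, 2r-3 and r-2 into 2m+3,
    2m+1 and m; the sum then has m+1 = r-1 terms.\<close>
  obtain m where m: "r = m + 2" using r by (metis add.commute le_Suc_ex)
  let ?P = "\<lambda>k. cov_deriv_pow_T A D I \<gamma> k t"
  let ?R = "curv A D (\<gamma> t) (N t) (T t) (T t)"
  let ?a = "(-1) ^ m * \<kappa> ^ (2 * m + 1)"
  note p = curve_in_topspace[OF t]
  have summand: "(-1) ^ l *\<^sub>R curv A D (\<gamma> t) (?P (2 * m + 1 - l)) (?P l) (T t) = ?a *\<^sub>R ?R"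
    if "l \<le> m" for l
  proof (cases "even l")
    case True
    then obtain j where j: "l = 2 * j" by (elim evenE)
    define i where "i = m - j"
    have i: "m = i + j" "2 * m + 1 - l = 2 * i + 1" using that j by (auto simp: i_def)
    have "(-1) ^ l *\<^sub>R curv A D (\<gamma> t) (?P (2 * m + 1 - l)) (?P l) (T t) =
        (((-1) ^ i * \<kappa> ^ (2 * i + 1)) * ((-1) ^ j * \<kappa> ^ (2 * j))) *\<^sub>R ?R"
      unfolding i(2) unfolding j cov_deriv_pow_T_even[OF t] cov_deriv_pow_T_odd[OF t] curv_scaleR[OF p]
      by simp
    also have "((-1) ^ i * \<kappa> ^ (2 * i + 1)) * ((-1) ^ j * \<kappa> ^ (2 * j)) = ?a"
      by (simp add: i(1) power_add distrib_left)
    finally show ?thesis .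
  next
    case False
    then obtain j where j: "l = 2 * j + 1" by (elim oddE)
    define i where "i = m - j"
    have i: "m = i + j" "2 * m + 1 - l = 2 * i" using that j by (auto simp: i_def)
    have "(-1) ^ l *\<^sub>R curv A D (\<gamma> t) (?P (2 * m + 1 - l)) (?P l) (T t) =
        (((-1) ^ i * \<kappa> ^ (2 * i)) * ((-1) ^ j * \<kappa> ^ (2 * j + 1))) *\<^sub>R ?R"
      unfolding i(2) unfolding j cov_deriv_pow_T_even[OF t] cov_deriv_pow_T_odd[OF t] curv_scaleR[OF p]
        curv_antisym[OF p, of "N t" "T t"]
      by simp
    also have "((-1) ^ i * \<kappa> ^ (2 * i)) * ((-1) ^ j * \<kappa> ^ (2 * j + 1)) = ?a"
      by (simp add: i(1) power_add distrib_left)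
    finally show ?thesis .
  qed
  have "tension A D I r \<gamma> t = ?P (2 * (m + 1) + 1) +
      (\<Sum>l = 0..m. (-1) ^ l *\<^sub>R curv A D (\<gamma> t) (?P (2 * m + 1 - l)) (?P l) (T t))"
    by (simp add: tension_def m T)
  also have "\<dots> = ((-1) ^ (m + 1) * \<kappa> ^ (2 * (m + 1) + 1)) *\<^sub>R N t + (real m + 1) *\<^sub>R (?a *\<^sub>R ?R)"
    unfolding cov_deriv_pow_T_odd[OF t] using summand by (simp add: sum_constant_scaleR)
  \<comment> \<open>The leading derivative carries (-1)^(m+1) and each summand (-1)^m, which
    produces the minus sign in the bracket.\<close>
  also have "\<dots> = ((-1) ^ (m + 1) * \<kappa> ^ (2 * m + 1)) *\<^sub>R (\<kappa>\<^sup>2 *\<^sub>R N t - (real m + 1) *\<^sub>R ?R)"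
    by (simp add: scaleR_diff_right power2_eq_square mult_ac)
  finally show ?thesis by (simp add: m)
qed

end

theorem corollary1p5:
  fixes M :: "'a topology"
    and A :: "('a, 'n::{finite,linorder}) chart set"
    and g :: "'a \<Rightarrow> ('a, 'n) tvec \<Rightarrow> ('a, 'n) tvec \<Rightarrow> real"
    and D :: "('a, 'n) conn"
    and I :: "real set"
    and \<gamma> :: "real \<Rightarrow> 'a"
    and T N :: "real \<Rightarrow> ('a, 'n) tvec"
    and \<kappa> :: real
    and r :: nat
  assumes "oriented_manifold M A"
    and "CARD('n) \<ge> 2"
    and "riemannian_metric M A g"
    and "levi_civita M A g D"
    and "frenet_helix2 M A g D I \<gamma> N \<kappa>"
    and "T = velocity A I \<gamma>"
    and "r \<ge> 2"
    and "\<forall>t\<in>I. \<forall>W \<in> tangent_space A (\<gamma> t).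
           (\<forall>U \<in> span {T t, N t}. g (\<gamma> t) U W = 0) \<longrightarrow>
           g (\<gamma> t) (curv A D (\<gamma> t) (T t) (N t) (T t)) W = 0"
  shows "proper_r_harmonic M A g D I r \<gamma> \<longleftrightarrow>
           \<kappa> \<noteq> 0 \<and> (\<forall>t\<in>I. \<kappa>\<^sup>2 = (real r - 1) * curv4 A g D (\<gamma> t) (N t) (T t) (N t) (T t))"
proof -
  have unit: "unit_speed_curve M A g I \<gamma>"
    and N: "smooth_field_along A I \<gamma> N"
    and frenet: "\<And>t. t \<in> I \<Longrightarrow> g (\<gamma> t) (N t) (N t) = 1 \<and> g (\<gamma> t) (T t) (N t) = 0 \<and>
      cov_deriv A D I \<gamma> T t = \<kappa> *\<^sub>R N t \<and> cov_deriv A D I \<gamma> N t = - \<kappa> *\<^sub>R T t"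
    using assms(5) by (auto simp: frenet_helix2_def Let_def assms(6))
  have N_diff: "(\<lambda>s. comp (N s) c) differentiable (at t within I)"
    if "c \<in> A" "t \<in> I" "\<gamma> t \<in> cdom c" for c t
  proof -
    have "nth_deriv_within I 0 (\<lambda>s. comp (N s) c) differentiable (at t within I)"
      using N that unfolding smooth_field_along_def by blast
    then show ?thesis by simp
  qed
  interpret frenet_curve M A g D I \<gamma> T N \<kappa>
    by unfold_locales
      (use assms(1,3,4,6) unit frenet N_diff in \<open>auto simp: oriented_manifold_def unit_speed_curve_def\<close>)
  have tan: "T t \<in> tangent_space A (\<gamma> t)" "N t \<in> tangent_space A (\<gamma> t)" if "t \<in> I" for t
    using velocity_in_tangent_space[OF that] N that by (auto simp: T smooth_field_along_def)
  have nz: "N t \<noteq> 0" if "t \<in> I" for t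
    using frenet[OF that] g_zero_left[OF curve_in_topspace[OF that] tangent_space_zero] by auto
  \<comment> \<open>Over an empty interval every curve would be a geodesic vacuously, whatever
    \<kappa> is.\<close>
  have "I \<noteq> {}"
    using smooth_curve by (auto simp: smooth_curve_def)
  then have geodesic: "geodesic A D I \<gamma> \<longleftrightarrow> \<kappa> = 0"
    using frenet nz unfolding geodesic_def assms(6)[symmetric] by auto
  have "tension A D I r \<gamma> t = 0 \<longleftrightarrow>
      \<kappa>\<^sup>2 = (real r - 1) * curv4 A g D (\<gamma> t) (N t) (T t) (N t) (T t)" if t: "t \<in> I" "\<kappa> \<noteq> 0" for t
  proof -
    have "g (\<gamma> t) (T t) (T t) = 1"
      using unit t(1) by (simp add: unit_speed_curve_def T)
    then have "curv A D (\<gamma> t) (N t) (T t) (T t) =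
        curv4 A g D (\<gamma> t) (N t) (T t) (N t) (T t) *\<^sub>R N t"
      using assms(8) t(1) frenet[OF t(1)]
      by (intro curv_eq_scaleR_normal curve_in_topspace tan) auto
    \<comment> \<open>All of the tension now lies along the nonzero vector \<open>N t\<close>, and
      the power of \<kappa> in front does not vanish, so the scalar difference decides.\<close>
    then have "tension A D I r \<gamma> t = ((-1) ^ (r - 1) * \<kappa> ^ (2 * r - 3) *
        (\<kappa>\<^sup>2 - (real r - 1) * curv4 A g D (\<gamma> t) (N t) (T t) (N t) (T t))) *\<^sub>R N t"
      by (simp add: tension_eq[OF t(1) assms(7)] scaleR_diff_left scaleR_diff_right right_diff_distrib)
    then show ?thesis
      using t(2) nz[OF t(1)] by simp
  qed
  then show ?thesis
    using unit geodesic unfolding proper_r_harmonic_def r_harmonic_def by blast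
qed

end
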